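(* For every $d\in\mathbb{N}$, every $p\in[1,\infty]$ and every $\delta\in(0,1)$ there exist $B_{d,p,\delta},C_{d,p,\delta}>0$, depending only on $d$, $p$ and $\delta$, with the following property: for every prime number $N$ there exist at least $\lceil\delta(N-1)^d\rceil$ vectors $\boldsymbol{g}\in\{1,\ldots,N-1\}^d$ such that $$\rho_p(P(\boldsymbol{g},N))\le B_{d,p,\delta}\qquad\text{and}\qquad D_N^*(P(\boldsymbol{g},N))\le C_{d,p,\delta}\frac{(\log N)^d}{N}.$$
   Context: For $\boldsymbol{g}\in\{1,\ldots,N-1\}^d$, the rank-1 lattice point set is $P(\boldsymbol{g},N)=\left\{\left\{\frac{k}{N}\boldsymbol{g}\right\} : k\in\{0,1,\ldots,N-1\}\right\}\subset[0,1)^d$, where the inner braces denote the componentwise fractional part. For a finite set $P\subset[0,1]^d$ with $|P|\ge2$: $h_p(P)=\sup_{\boldsymbol{x}\in[0,1]^d}\min_{\boldsymbol{y}\in P}\|\boldsymbol{x}-\boldsymbol{y}\|_p$, $q_p(P)=\min_{\boldsymbol{x}\neq\boldsymbol{y}\in P}\|\boldsymbol{x}-\boldsymbol{y}\|_p/2$, and the mesh ratio is $\rho_p(P)=h_p(P)/q_p(P)$. The star-discrepancy of an $N$-point set $P$ in $[0,1)^d$ is $D_N^*(P)=\sup_{\boldsymbol{a}\in[0,1]^d}\left|\frac{|P\cap[\boldsymbol{0},\boldsymbol{a})|}{N}-\prod_{j=1}^d a_j\right|$. *)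

theory Defs
  imports "HOL-Analysis.Analysis" "HOL-Computational_Algebra.Primes"
begin

text \<open>The dimension \<open>d \<ge> 1\<close> is \<open>CARD('d)\<close>; the unit cube \<open>[0,1]\<^sup>d\<close> is \<open>cbox 0 1\<close>, where
  \<open>1\<close> is the all-ones vector.\<close>

text \<open>The exponent ranges over \<open>[1,\<infinity>]\<close>. The library's \<^const>\<open>infnorm\<close> is the maximum of the
  absolute values of the coordinates.\<close>

definition lp_norm :: "ereal \<Rightarrow> real ^ 'd \<Rightarrow> real" where
  "lp_norm p x =
     (if p = \<infinity> then infnorm x
      else (\<Sum>i\<in>UNIV. \<bar>x $ i\<bar> powr real_of_ereal p) powr (1 / real_of_ereal p))"

definition covering_radius :: "ereal \<Rightarrow> (real ^ 'd) set \<Rightarrow> real" where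
  "covering_radius p P = (SUP x\<in>cbox 0 1. Min ((\<lambda>y. lp_norm p (x - y)) ` P))"

definition separation_radius :: "ereal \<Rightarrow> (real ^ 'd) set \<Rightarrow> real" where
  "separation_radius p P = Min {lp_norm p (x - y) | x y. x \<in> P \<and> y \<in> P \<and> x \<noteq> y} / 2"

text \<open>The following is meaningful only for finite \<open>P\<close> with at least two points. The point sets
  below satisfy this, as \<open>N\<close> is prime and no component of \<open>g\<close> is divisible by \<open>N\<close>.\<close>

definition mesh_ratio :: "ereal \<Rightarrow> (real ^ 'd) set \<Rightarrow> real" where
  "mesh_ratio p P = covering_radius p P / separation_radius p P"

definition star_discrepancy :: "(real ^ 'd) set \<Rightarrow> real" where
  "star_discrepancy P =
     (SUP a\<in>cbox 0 1.
        \<bar>real (card (P \<inter> {x. \<forall>i. 0 \<le> x $ i \<and> x $ i < a $ i})) / real (card P)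
          - (\<Prod>i\<in>UNIV. a $ i)\<bar>)"

definition lattice_points :: "nat ^ 'd \<Rightarrow> nat \<Rightarrow> (real ^ 'd) set" where
  "lattice_points g N = (\<lambda>k. \<chi> i. frac (real k / real N * real (g $ i))) ` {0..N - 1}"

definition generators :: "nat \<Rightarrow> (nat ^ 'd) set" where
  "generators N = {g. \<forall>i. g $ i \<in> {1..N - 1}}"

end

theory Submission
  imports Defs "HOL-Number_Theory.Cong"
begin

text \<open>
  Put \<open>\<epsilon> = (1 - \<delta>) / 3\<close>. Each of the following three properties fails for at most
  \<open>\<epsilon> (N - 1)\<^sup>d\<close> generators, by a first moment argument over the generators.

  Separation: for fixed \<open>k \<noteq> 0\<close> the residue of \<open>k g\<close> is uniformly distributed on the
  vectors with nonzero entries, so it rarely comes within \<open>c N\<^sup>1\<^sup>-\<^sup>1\<^sup>/\<^sup>d\<close> of the origin for any of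
  the \<open>N - 1\<close> values of \<open>k\<close>.

  Covering: let \<open>A\<close> be the set of residues \<open>k g + u\<close> with \<open>u\<close> in a box of side
  \<open>m \<approx> C N\<^sup>1\<^sup>-\<^sup>1\<^sup>/\<^sup>d\<close>. The average number of collisions among these sums shows, by the
  Cauchy-Schwarz inequality, that \<open>A\<close> usually contains more than half of all residue vectors.
  Then \<open>A - A\<close> is everything, and since the multiples of \<open>g\<close> form a group, every box of side
  about \<open>2 m\<close> contains one of them.

  Discrepancy: expanding the indicator of a box into characters bounds the discrepancy by the sum of
  \<open>\<Prod>\<^sub>i w (h\<^sub>i)\<close> over the nonzero \<open>h\<close> with \<open>h \<bullet> g \<equiv> 0\<close> mod \<open>N\<close>, where
  \<open>\<Sum>\<^sub>h w h\<close> is of order \<open>log N\<close>. A given \<open>h\<close> is orthogonal to a proportion of at most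
  \<open>1 / (N - 1)\<close> of the generators.
\<close>

subsection \<open>Counting\<close>

text \<open>\<open>c\<close> is invertible modulo the prime \<open>N\<close>, and two numbers in
  \<open>{0..<N}\<close> that are congruent modulo \<open>N\<close> coincide. Differences are taken
  in \<open>int\<close> to avoid truncation.\<close>

lemma prime_cancel_residue:
  assumes "prime N" "\<not> int N dvd c" "int N dvd c * (int x - int y)" "x < N" "y < N"
  shows "x = y"
proof -
  have "int N dvd int x - int y"
    using assms prime_dvd_mult_iff[of "int N"] by (auto simp: prime_int_nat_transfer)
  then show ?thesis
    using assms dvd_imp_le_int[of "int x - int y" "int N"] by linarith
qed

lemma not_dvd_diff:
  assumes "k < N" "l < N" "k \<noteq> l"
  shows "\<not> int N dvd int k - int l"
  using assms dvd_imp_le_int[of "int k - int l" "int N"] by auto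

lemma card_Markov:
  fixes f :: "'a \<Rightarrow> real"
  assumes "finite A" "\<And>x. x \<in> A \<Longrightarrow> f x \<ge> 0" "t > 0"
  shows "t * real (card {x \<in> A. t \<le> f x}) \<le> sum f A"
proof -
  have "t * real (card {x \<in> A. t \<le> f x}) = (\<Sum>x\<in>{x \<in> A. t \<le> f x}. t)" by simp
  also have "\<dots> \<le> (\<Sum>x\<in>{x \<in> A. t \<le> f x}. f x)" by (intro sum_mono) auto
  also have "\<dots> \<le> sum f A" using assms by (intro sum_mono2) auto
  finally show ?thesis .
qed

lemma sum_card_swap:
  assumes "finite A" "finite B"
  shows "(\<Sum>x\<in>A. card {y \<in> B. R x y}) = (\<Sum>y\<in>B. card {x \<in> A. R x y})"
  using sum.swap_restrict[OF assms, of "\<lambda>_ _. 1::nat" R] by (simp only: card_eq_sum)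

subsection \<open>Separation\<close>

text \<open>For fixed \<open>k\<close>, multiplication by \<open>k\<close> permutes the nonzero
  residues, so each coordinate has at most \<open>2 * r\<close> bad values. The coordinates are
  independent, and a union bound over \<open>k\<close> gives the factor \<open>N - 1\<close>.
  Generators are functions here so that they can be counted with \<open>PiE\<close>.\<close>

lemma card_close_multiples_le:
  assumes N: "prime N" and r: "r \<ge> 0"
  shows "real (card {g \<in> (UNIV \<rightarrow>\<^sub>E {1..<N} :: ('d::finite \<Rightarrow> nat) set).
      \<exists>k\<in>{1..<N}. \<forall>i. real ((k * g i) mod N) \<le> r \<or> real N - real ((k * g i) mod N) \<le> r})
    \<le> real (N - 1) * (2 * r) ^ CARD('d)"
proof -
  let ?near = "\<lambda>z. real (z mod N) \<le> r \<or> real N - real (z mod N) \<le> r"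
  let ?G = "UNIV \<rightarrow>\<^sub>E {1..<N} :: ('d \<Rightarrow> nat) set"
  have one: "real (card {y \<in> {1..<N}. ?near (k * y)}) \<le> 2 * r" if k: "k \<in> {1..<N}" for k
  proof -
    have Nk: "\<not> int N dvd int k" using k by (auto dest: nat_dvd_not_less)
    have inj: "inj_on (\<lambda>y. (k * y) mod N) {y \<in> {1..<N}. ?near (k * y)}"
    proof (rule inj_onI)
      fix x y assume xy: "x \<in> {y \<in> {1..<N}. ?near (k * y)}" "y \<in> {y \<in> {1..<N}. ?near (k * y)}"
        and "(k * x) mod N = (k * y) mod N"
      then have "int N dvd int (k * x) - int (k * y)"
        by (metis mod_eq_dvd_iff of_nat_mod)
      then have "int N dvd int k * (int x - int y)" by (simp add: algebra_simps)
      then show "x = y" using prime_cancel_residue[OF N Nk] xy by auto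
    qed
    \<comment> \<open>Zero is not a value of \<open>k * y mod N\<close>, hence no extra
      \<open>+ 1\<close> in the bound. In dimension 1 the lemma is later applied with
      \<open>r < 1\<close>, where such a term would be fatal.\<close>
    have sub: "(\<lambda>y. (k * y) mod N) ` {y \<in> {1..<N}. ?near (k * y)}
        \<subseteq> {1..nat \<lfloor>r\<rfloor>} \<union> (\<lambda>z. N - z) ` {1..nat \<lfloor>r\<rfloor>}"
    proof (rule image_subsetI)
      fix y assume y: "y \<in> {y \<in> {1..<N}. ?near (k * y)}"
      define z where "z = (k * y) mod N"
      have "\<not> N dvd k * y"
        using N y k by (auto simp: prime_dvd_mult_iff dest: nat_dvd_not_less)
      then have z: "0 < z" "z < N" using N by (simp_all add: z_def prime_gt_0_nat mod_greater_zero_iff_not_dvd)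
      from y consider "real z \<le> r" | "real N - real z \<le> r" by (auto simp: z_def)
      then show "(k * y) mod N \<in> {1..nat \<lfloor>r\<rfloor>} \<union> (\<lambda>z. N - z) ` {1..nat \<lfloor>r\<rfloor>}"
      proof cases
        case 1
        then show ?thesis using z by (simp add: z_def [symmetric] le_nat_floor)
      next
        case 2
        then have "N - z \<in> {1..nat \<lfloor>r\<rfloor>}"
          using z by (auto intro!: le_nat_floor simp: of_nat_diff)
        moreover have "z = N - (N - z)" using z by simp
        ultimately show ?thesis unfolding z_def [symmetric] by blast
      qed
    qed
    have "card {y \<in> {1..<N}. ?near (k * y)} \<le> card ({1..nat \<lfloor>r\<rfloor>} \<union> (\<lambda>z. N - z) ` {1..nat \<lfloor>r\<rfloor>})"
      by (rule card_inj_on_le[OF inj sub]) auto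
    also have "\<dots> \<le> nat \<lfloor>r\<rfloor> + nat \<lfloor>r\<rfloor>"
      by (rule order.trans[OF card_Un_le]) (intro add_mono order.trans[OF card_image_le], auto)
    finally have "real (card {y \<in> {1..<N}. ?near (k * y)}) \<le> 2 * real (nat \<lfloor>r\<rfloor>)" by linarith
    also have "\<dots> \<le> 2 * r" using r by simp
    finally show ?thesis .
  qed
  have "card {g \<in> ?G. \<exists>k\<in>{1..<N}. \<forall>i. ?near (k * g i)}
      \<le> card (\<Union>k\<in>{1..<N}. UNIV \<rightarrow>\<^sub>E {y \<in> {1..<N}. ?near (k * y)} :: ('d \<Rightarrow> nat) set)"
    by (rule card_mono) (auto intro!: finite_PiE simp: PiE_iff)
  also have "\<dots> \<le> (\<Sum>k\<in>{1..<N}. card (UNIV \<rightarrow>\<^sub>E {y \<in> {1..<N}. ?near (k * y)} :: ('d \<Rightarrow> nat) set))"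
    by (rule card_UN_le) simp
  finally have "real (card {g \<in> ?G. \<exists>k\<in>{1..<N}. \<forall>i. ?near (k * g i)})
      \<le> (\<Sum>k\<in>{1..<N}. real (card {y \<in> {1..<N}. ?near (k * y)}) ^ CARD('d))"
    by (simp add: card_funcsetE flip: of_nat_sum of_nat_power)
  also have "\<dots> \<le> (\<Sum>k\<in>{1..<N}. (2 * r) ^ CARD('d))"
    by (intro sum_mono power_mono one) auto
  finally show ?thesis by simp
qed

subsection \<open>Covering\<close>

text \<open>Cauchy-Schwarz for the fibre sizes of \<open>f\<close>: they add up to
  \<open>card X\<close>, and their squares add up to the number of ordered colliding pairs.\<close>

lemma card_image_collisions:
  assumes "finite X"
  shows "(real (card X))\<^sup>2 \<le> real (card (f ` X)) * real (\<Sum>a\<in>X. card {b \<in> X. f a = f b})"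
proof -
  let ?r = "\<lambda>y. card {a \<in> X. f a = y}"
  have "real (card X) = (\<Sum>y\<in>f ` X. real (?r y) * 1)"
    using assms sum.image_gen[of X "\<lambda>_. 1::nat" f] by simp
  then have "(real (card X))\<^sup>2 \<le> (\<Sum>y\<in>f ` X. (real (?r y))\<^sup>2) * (\<Sum>y\<in>f ` X. 1\<^sup>2)"
    by (simp only: Cauchy_Schwarz_ineq_sum)
  also have "(\<Sum>y\<in>f ` X. (real (?r y))\<^sup>2) = real (\<Sum>a\<in>X. ?r (f a))"
    using assms sum.image_gen[of X "\<lambda>a. ?r (f a)" f] by (simp add: power2_eq_square)
  also have "(\<Sum>a\<in>X. ?r (f a)) = (\<Sum>a\<in>X. card {b \<in> X. f a = f b})"
    by (simp only: eq_commute)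
  finally show ?thesis by (simp add: mult.commute)
qed

section \<open>Collisions among the sums \<open>k g + u\<close>\<close>

definition box_shifts :: "nat \<Rightarrow> nat \<Rightarrow> (nat \<times> ('d::finite \<Rightarrow> nat)) set" where
  "box_shifts N m = {..<N} \<times> (UNIV \<rightarrow>\<^sub>E {..<m})"

definition shifted_point :: "nat \<Rightarrow> ('d \<Rightarrow> nat) \<Rightarrow> nat \<times> ('d \<Rightarrow> nat) \<Rightarrow> 'd \<Rightarrow> nat" where
  "shifted_point N g a = (\<lambda>i. (fst a * g i + snd a i) mod N)"

text \<open>Ordered pairs are counted, the diagonal included, so that this is the sum of the squared
  fibre sizes of \<open>shifted_point N g\<close>.\<close>

definition collisions :: "nat \<Rightarrow> nat \<Rightarrow> ('d::finite \<Rightarrow> nat) \<Rightarrow> nat" where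
  "collisions N m g =
    (\<Sum>a\<in>box_shifts N m. card {b \<in> box_shifts N m. shifted_point N g a = shifted_point N g b})"

lemma finite_box_shifts [simp]: "finite (box_shifts N m)"
  by (auto simp: box_shifts_def intro!: finite_PiE)

lemma card_box_shifts: "card (box_shifts N m :: (nat \<times> ('d::finite \<Rightarrow> nat)) set) = N * m ^ CARD('d)"
  by (simp add: box_shifts_def card_funcsetE card_cartesian_product)

text \<open>Write \<open>a = (k, u)\<close> and \<open>b = (l, v)\<close>. A collision means that
  \<open>(k - l) * g i\<close> is congruent to \<open>v i - u i\<close> for all \<open>i\<close>. If
  \<open>k \<noteq> l\<close>, this fixes every \<open>g i\<close>, and as \<open>g i\<close> is
  nonzero it forces \<open>u i \<noteq> v i\<close> everywhere. If \<open>k = l\<close>, it forces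
  \<open>u = v\<close> because \<open>m \<le> N\<close>.\<close>

lemma card_colliding_generators_le:
  fixes a b :: "nat \<times> ('d::finite \<Rightarrow> nat)"
  assumes N: "prime N" and m: "m \<le> N" and a: "a \<in> box_shifts N m" and b: "b \<in> box_shifts N m"
  shows "card {g \<in> UNIV \<rightarrow>\<^sub>E {1..<N}. shifted_point N g a = shifted_point N g b}
    \<le> (if a = b then (N - 1) ^ CARD('d)
       else if fst a \<noteq> fst b \<and> (\<forall>i. snd a i \<noteq> snd b i) then 1 else 0)"
proof -
  let ?S = "{g \<in> UNIV \<rightarrow>\<^sub>E {1..<N}. shifted_point N g a = shifted_point N g b}"
  have lt: "fst a < N" "fst b < N" "snd a i < N" "snd b i < N" for i
  proof -
    have "snd a i < m" "snd b i < m" using a b by (auto simp: box_shifts_def)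
    with m show "snd a i < N" "snd b i < N" by simp_all
  qed (use a b in \<open>auto simp: box_shifts_def\<close>)
  have dvd: "int N dvd (int (fst a) - int (fst b)) * int (g i) + (int (snd a i) - int (snd b i))"
    if "g \<in> ?S" for g i
  proof -
    have "(fst a * g i + snd a i) mod N = (fst b * g i + snd b i) mod N"
      using that by (auto simp: shifted_point_def dest: fun_cong)
    then have "int N dvd int (fst a * g i + snd a i) - int (fst b * g i + snd b i)"
      by (metis mod_eq_dvd_iff of_nat_mod)
    then show ?thesis by (simp add: algebra_simps)
  qed
  show ?thesis
  proof (cases "a = b")
    case True
    then show ?thesis by (simp add: card_funcsetE)
  next
    case ab: False
    show ?thesis
    proof (cases "fst a \<noteq> fst b \<and> (\<forall>i. snd a i \<noteq> snd b i)")
      case True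
      have nd: "\<not> int N dvd int (fst a) - int (fst b)" using True lt by (intro not_dvd_diff) auto
      have "g = g'" if g: "g \<in> ?S" "g' \<in> ?S" for g g'
      proof
        fix i
        have "int N dvd (int (fst a) - int (fst b)) * (int (g i) - int (g' i))"
          using dvd_diff[OF dvd[OF g(1), of i] dvd[OF g(2), of i]] by (simp add: algebra_simps)
        then show "g i = g' i" using g by (intro prime_cancel_residue[OF N nd]) (auto simp: PiE_iff)
      qed
      then have "card ?S \<le> 1" by (auto simp: card_le_Suc0_iff_eq finite_PiE)
      with ab True show ?thesis by simp
    next
      case False
      have "?S = {}"
      proof (rule ccontr)
        assume "?S \<noteq> {}"
        then obtain g where g: "g \<in> ?S" by blast
        have gi: "\<not> int N dvd int (g i)" for i
          using g by (auto simp: PiE_iff dest!: nat_dvd_not_less spec[of _ i])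
        show False
        proof (cases "fst a = fst b")
          case True
          have "snd a i = snd b i" for i
            using dvd[OF g, of i] True not_dvd_diff[OF lt(3) lt(4), of i i] by auto
          then show False using True ab by (auto simp: prod_eq_iff)
        next
          case ne: False
          then obtain i where "snd a i = snd b i" using False by auto
          then have "int N dvd (int (g i)) * (int (fst a) - int (fst b))"
            using dvd[OF g, of i] by (simp add: mult.commute)
          then show False using prime_cancel_residue[OF N gi] lt ne by blast
        qed
      qed
      then show ?thesis by (simp only: card.empty)
    qed
  qed
qed

text \<open>After exchanging the sums, each \<open>a\<close> receives the diagonal term and at most
  1 from each \<open>b\<close> that differs from it in every component. Having \<open>m - 1\<close>
  in place of \<open>m\<close> is what makes the comparison with the Cauchy-Schwarz bound
  succeed.\<close>

lemma sum_collisions_le: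
  assumes N: "prime N" and m: "1 \<le> m" "m \<le> N"
  shows "(\<Sum>g\<in>(UNIV \<rightarrow>\<^sub>E {1..<N} :: ('d::finite \<Rightarrow> nat) set). collisions N m g)
    \<le> N * m ^ CARD('d) * ((N - 1) ^ CARD('d) + (N - 1) * (m - 1) ^ CARD('d))"
proof -
  let ?G = "UNIV \<rightarrow>\<^sub>E {1..<N} :: ('d \<Rightarrow> nat) set"
  let ?X = "box_shifts N m :: (nat \<times> ('d \<Rightarrow> nat)) set"
  let ?c = "\<lambda>a b. card {g \<in> ?G. shifted_point N g a = shifted_point N g b}"
  have fin: "finite ?G" by (intro finite_PiE) auto
  have row: "(\<Sum>b\<in>?X. ?c a b) \<le> (N - 1) ^ CARD('d) + (N - 1) * (m - 1) ^ CARD('d)"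
    if a: "a \<in> ?X" for a
  proof -
    let ?D = "{b \<in> ?X. fst a \<noteq> fst b \<and> (\<forall>i. snd a i \<noteq> snd b i)}"
    have "(\<Sum>b\<in>?X. ?c a b) \<le> (\<Sum>b\<in>?X. (if a = b then (N - 1) ^ CARD('d) else 0)
        + (if fst a \<noteq> fst b \<and> (\<forall>i. snd a i \<noteq> snd b i) then 1 else 0))"
      by (rule sum_mono, rule order.trans[OF card_colliding_generators_le[OF N m(2) a]]) auto
    also have "\<dots> = (N - 1) ^ CARD('d) + card ?D"
      using a by (simp add: sum.distrib flip: sum.inter_filter)
    also have "?D = ({..<N} - {fst a}) \<times> (\<Pi>\<^sub>E i\<in>UNIV. {..<m} - {snd a i})"
      by (auto simp: box_shifts_def PiE_iff eq_commute[of "snd a _"])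
    also have "card \<dots> = (N - 1) * (m - 1) ^ CARD('d)"
    proof -
      have "fst a < N" "\<And>i. snd a i < m" using a by (auto simp: box_shifts_def)
      then show ?thesis by (simp add: card_cartesian_product card_PiE)
    qed
    finally show ?thesis by simp
  qed
  have "(\<Sum>g\<in>?G. collisions N m g) = (\<Sum>a\<in>?X. \<Sum>b\<in>?X. ?c a b)"
    unfolding collisions_def by (subst sum.swap) (intro sum.cong refl sum_card_swap fin finite_box_shifts)
  also have "\<dots> \<le> (\<Sum>a\<in>?X. (N - 1) ^ CARD('d) + (N - 1) * (m - 1) ^ CARD('d))"
    by (intro sum_mono row)
  also have "\<dots> = N * m ^ CARD('d) * ((N - 1) ^ CARD('d) + (N - 1) * (m - 1) ^ CARD('d))"
    by (simp add: card_box_shifts)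
  finally show ?thesis .
qed

section \<open>From few collisions to covering\<close>

text \<open>The entries of \<open>j g - c\<close> are written as differences \<open>t - s\<close> of
  elements of \<open>{..<m}\<close>, with the summands on opposite sides so that the congruence
  stays in \<open>nat\<close>.\<close>

definition box_covering :: "nat \<Rightarrow> nat \<Rightarrow> ('d \<Rightarrow> nat) \<Rightarrow> bool" where
  "box_covering N m g \<longleftrightarrow>
    (\<forall>c. \<exists>j<N. \<forall>i. \<exists>s<m. \<exists>t<m. [j * g i + s = c i + t] (mod N))"

text \<open>Pigeonhole: the image and its translate by \<open>c\<close> each contain more than half
  of all residue vectors, so they meet. A common point \<open>k g + u = l g + v + c\<close> yields
  the multiple \<open>(k - l) g\<close>.\<close>

lemma box_covering_if_more_than_half:
  fixes g :: "'d::finite \<Rightarrow> nat"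
  assumes N: "N > 0" and half: "N ^ CARD('d) < 2 * card (shifted_point N g ` box_shifts N m)"
  shows "box_covering N m g"
  unfolding box_covering_def
proof
  fix c :: "'d \<Rightarrow> nat"
  let ?A = "shifted_point N g ` box_shifts N m"
  let ?B = "UNIV \<rightarrow>\<^sub>E {..<N} :: ('d \<Rightarrow> nat) set"
  let ?\<tau> = "\<lambda>x i. (x i + c i) mod N"
  have fin: "finite ?B" by (intro finite_PiE) auto
  have AB: "?A \<subseteq> ?B" using N by (auto simp: shifted_point_def)
  have "inj_on ?\<tau> ?B"
  proof (rule inj_onI)
    fix x y assume xy: "x \<in> ?B" "y \<in> ?B" and eq: "?\<tau> x = ?\<tau> y"
    show "x = y"
    proof
      fix i
      have "[x i + c i = y i + c i] (mod N)" using fun_cong[OF eq, of i] by (simp add: cong_def)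
      then have "[x i = y i] (mod N)" by (simp add: cong_add_rcancel_nat)
      moreover have "x i < N" "y i < N" using xy by auto
      ultimately show "x i = y i" by (simp add: cong_less_modulus_unique_nat)
    qed
  qed
  then have "card (?\<tau> ` ?A) = card ?A" using AB by (intro card_image) (rule inj_on_subset)
  moreover have "?\<tau> ` ?A \<subseteq> ?B" using N by auto
  then have "card (?A \<union> ?\<tau> ` ?A) \<le> N ^ CARD('d)"
    using card_mono[OF fin, of "?A \<union> ?\<tau> ` ?A"] AB by (simp add: card_funcsetE)
  moreover have "card (?A \<union> ?\<tau> ` ?A) = card ?A + card (?\<tau> ` ?A)" if "?A \<inter> ?\<tau> ` ?A = {}"
    using that by (intro card_Un_disjoint) auto
  ultimately have "?A \<inter> ?\<tau> ` ?A \<noteq> {}" using half by linarith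
  then obtain a b where ab: "a \<in> box_shifts N m" "b \<in> box_shifts N m"
    and eq: "shifted_point N g a = ?\<tau> (shifted_point N g b)" by blast
  \<comment> \<open>Represents \<open>fst a - fst b\<close> modulo \<open>N\<close>; adding
    \<open>N\<close> first keeps the subtraction exact.\<close>
  define j where "j = (fst a + N - fst b) mod N"
  have bN: "fst b < N" using ab by (auto simp: box_shifts_def)
  have "\<exists>s<m. \<exists>t<m. [j * g i + s = c i + t] (mod N)" for i
  proof (intro exI conjI)
    show "snd a i < m" "snd b i < m" using ab by (auto simp: box_shifts_def)
    have b_a: "[fst a * g i + snd a i = fst b * g i + snd b i + c i] (mod N)"
      using fun_cong[OF eq, of i] by (simp add: shifted_point_def cong_def mod_simps)
    have j_a: "[fst b * g i + (j * g i + snd a i) = fst a * g i + snd a i] (mod N)"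
    proof -
      have "[j * g i = (fst a + N - fst b) * g i] (mod N)"
        unfolding j_def by (intro cong_mult) (auto simp: cong_def)
      then have "[fst b * g i + (j * g i + snd a i) = fst b * g i + ((fst a + N - fst b) * g i + snd a i)] (mod N)"
        by (intro cong_add) auto
      also have "fst b * g i + ((fst a + N - fst b) * g i + snd a i)
          = (fst b + (fst a + N - fst b)) * g i + snd a i" by (simp only: add_mult_distrib add.assoc)
      also have "fst b + (fst a + N - fst b) = fst a + N" using bN by simp
      also have "(fst a + N) * g i + snd a i = fst a * g i + snd a i + N * g i"
        by (simp add: algebra_simps)
      finally show ?thesis by (simp add: cong_def)
    qed
    have "[fst b * g i + (j * g i + snd a i) = fst b * g i + (c i + snd b i)] (mod N)"
      using cong_trans[OF j_a b_a] by (simp only: add.assoc add.commute[of "snd b i"])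
    then show "[j * g i + snd a i = c i + snd b i] (mod N)"
      by (simp only: cong_add_lcancel_nat)
  qed
  moreover have "j < N" using N by (simp add: j_def)
  ultimately show "\<exists>j<N. \<forall>i. \<exists>s<m. \<exists>t<m. [j * g i + s = c i + t] (mod N)" by blast
qed

text \<open>On average over \<open>g\<close>, the collisions exceed \<open>M\<close> by at most
  \<open>n * q\<close>, so by Markov the excess stays below \<open>t\<close> outside a proportion
  \<open>\<epsilon>\<close>. The hypothesis \<open>large\<close> gives \<open>t \<le> M\<close>;
  fewer than \<open>2 * M\<close> collisions then force an image larger than half of all residue
  vectors.\<close>

lemma card_not_box_covering_le:
  assumes N: "prime N" and m: "1 \<le> m" "m \<le> N" and \<epsilon>: "\<epsilon> > 0"
    and large: "real N ^ CARD('d) \<le> \<epsilon> * real N * real m ^ CARD('d)"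
  shows "real (card {g \<in> (UNIV \<rightarrow>\<^sub>E {1..<N} :: ('d::finite \<Rightarrow> nat) set). \<not> box_covering N m g})
    \<le> \<epsilon> * (real N - 1) ^ CARD('d)"
proof -
  let ?G = "UNIV \<rightarrow>\<^sub>E {1..<N} :: ('d \<Rightarrow> nat) set"
  let ?X = "box_shifts N m :: (nat \<times> ('d \<Rightarrow> nat)) set"
  define n where "n = real N"
  define q where "q = real m ^ CARD('d)"
  \<comment> \<open>By Cauchy-Schwarz, \<open>M\<close> is a lower bound for the number of collisions, attained by an
    equidistributed \<open>A\<close>. Markov's inequality is applied to the excess over \<open>M\<close>.\<close>
  define M where "M = n\<^sup>2 * q\<^sup>2 / n ^ CARD('d)"
  define t where "t = n * q / \<epsilon>"
  have n: "n \<ge> 2" using prime_ge_2_nat[OF N] by (simp add: n_def)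
  have q: "q \<ge> 1" using m by (simp add: q_def)
  have t: "t > 0" using n q \<epsilon> by (simp add: t_def)
  have fin: "finite ?G" by (intro finite_PiE) auto
  have cardG: "real (card ?G) = (n - 1) ^ CARD('d)"
    using prime_ge_2_nat[OF N] by (simp add: card_funcsetE n_def of_nat_diff)
  have CS: "(n * q)\<^sup>2 \<le> real (card (shifted_point N g ` ?X)) * real (collisions N m g)" for g
    using card_image_collisions[of ?X "shifted_point N g"]
    by (simp add: card_box_shifts n_def q_def collisions_def)
  have M_le: "M \<le> real (collisions N m g)" for g :: "'d \<Rightarrow> nat"
  proof -
    have "shifted_point N g ` ?X \<subseteq> UNIV \<rightarrow>\<^sub>E {..<N}"
      using prime_gt_0_nat[OF N] by (auto simp: shifted_point_def)
    then have "card (shifted_point N g ` ?X) \<le> card (UNIV \<rightarrow>\<^sub>E {..<N} :: ('d \<Rightarrow> nat) set)"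
      by (intro card_mono finite_PiE) auto
    then have "card (shifted_point N g ` ?X) \<le> N ^ CARD('d)" by (simp add: card_funcsetE)
    then have "real (card (shifted_point N g ` ?X)) \<le> n ^ CARD('d)"
      unfolding n_def by (metis of_nat_le_iff of_nat_power)
    then have "(n * q)\<^sup>2 \<le> n ^ CARD('d) * real (collisions N m g)"
      by (intro order.trans[OF CS[of g]] mult_right_mono) auto
    then show ?thesis using n by (simp add: M_def field_simps power_mult_distrib)
  qed
  have "real (\<Sum>g\<in>?G. collisions N m g) \<le> real (N * m ^ CARD('d) * ((N - 1) ^ CARD('d) + (N - 1) * (m - 1) ^ CARD('d)))"
    by (intro of_nat_mono sum_collisions_le N m)
  also have "\<dots> = n * q * (n - 1) ^ CARD('d) + n * q * (n - 1) * (real m - 1) ^ CARD('d)"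
  proof -
    have "real (N - 1) = n - 1" "real (m - 1) = real m - 1"
      using m prime_ge_2_nat[OF N] by (simp_all add: n_def of_nat_diff)
    then show ?thesis
      by (simp only: of_nat_mult of_nat_add of_nat_power n_def [symmetric] q_def [symmetric]
          distrib_left mult.assoc)
  qed
  also have "n * q * (n - 1) * (real m - 1) ^ CARD('d) \<le> M * (n - 1) ^ CARD('d)"
  proof -
    \<comment> \<open>A rearrangement of \<open>m \<le> N\<close>, that is
      \<open>(m - 1) / m \<le> (N - 1) / N\<close>. It lets the off-diagonal part of the average be
      absorbed by \<open>M\<close>.\<close>
    have "(real m - 1) * n \<le> real m * (n - 1)" using m by (simp add: n_def algebra_simps)
    then have "((real m - 1) * n) ^ CARD('d) \<le> (real m * (n - 1)) ^ CARD('d)"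
      using m n by (intro power_mono) auto
    then have "(real m - 1) ^ CARD('d) \<le> q * (n - 1) ^ CARD('d) / n ^ CARD('d)"
      using n by (simp only: power_mult_distrib q_def) (simp add: pos_le_divide_eq)
    then have "n * q * (n - 1) * (real m - 1) ^ CARD('d)
        \<le> n * q * n * (q * (n - 1) ^ CARD('d) / n ^ CARD('d))"
      using n q m by (intro mult_mono) auto
    then show ?thesis by (simp add: M_def power2_eq_square mult_ac)
  qed
  finally have "(\<Sum>g\<in>?G. real (collisions N m g) - M) \<le> n * q * (n - 1) ^ CARD('d)"
    by (simp only: sum_subtractf sum_constant cardG of_nat_sum) (simp add: mult.commute)
  moreover have "t * real (card {g \<in> ?G. t \<le> real (collisions N m g) - M})
      \<le> (\<Sum>g\<in>?G. real (collisions N m g) - M)"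
    by (rule card_Markov[OF fin _ t]) (use M_le in auto)
  ultimately have "t * real (card {g \<in> ?G. t \<le> real (collisions N m g) - M}) \<le> n * q * (n - 1) ^ CARD('d)"
    by linarith
  then have *: "real (card {g \<in> ?G. t \<le> real (collisions N m g) - M}) \<le> \<epsilon> * (n - 1) ^ CARD('d)"
    using n q \<epsilon> by (simp add: t_def field_simps)
  have "{g \<in> ?G. \<not> box_covering N m g} \<subseteq> {g \<in> ?G. t \<le> real (collisions N m g) - M}"
  proof clarify
    fix g :: "'d \<Rightarrow> nat" assume g: "\<not> box_covering N m g"
    show "t \<le> real (collisions N m g) - M"
    proof (rule ccontr)
      let ?a = "real (card (shifted_point N g ` ?X))"
      assume "\<not> t \<le> real (collisions N m g) - M"
      moreover have "t \<le> M"
      proof -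
        have "n * q * n ^ CARD('d) \<le> n * q * (\<epsilon> * n * q)"
          using large n q by (intro mult_left_mono) (auto simp: n_def q_def)
        then show ?thesis using n \<epsilon> by (simp add: t_def M_def field_simps power2_eq_square)
      qed
      ultimately have "real (collisions N m g) < 2 * M" by simp
      moreover have "?a > 0"
      proof (rule ccontr)
        assume "\<not> ?a > 0"
        then have "?a = 0" by linarith
        then show False using CS[of g] n q by simp
      qed
      ultimately have "(n * q)\<^sup>2 < ?a * (2 * M)"
        by (intro order.strict_trans1[OF CS[of g]] mult_strict_left_mono)
      then have "(n * q)\<^sup>2 * n ^ CARD('d) < (n * q)\<^sup>2 * (2 * ?a)"
        using n by (simp add: M_def field_simps power_mult_distrib)
      then have "n ^ CARD('d) < 2 * ?a"
        using n q by (simp add: mult_less_cancel_left_pos)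
      then have "real (N ^ CARD('d)) < real (2 * card (shifted_point N g ` ?X))"
        by (simp add: n_def)
      then have "N ^ CARD('d) < 2 * card (shifted_point N g ` ?X)" by (simp only: of_nat_less_iff)
      then show False
        using box_covering_if_more_than_half[OF prime_gt_0_nat[OF N]] g by blast
    qed
  qed
  then have "card {g \<in> ?G. \<not> box_covering N m g} \<le> card {g \<in> ?G. t \<le> real (collisions N m g) - M}"
    using fin by (intro card_mono) auto
  with * show ?thesis by (simp add: n_def)
qed

subsection \<open>Discrepancy\<close>

text \<open>Jordan's inequality: by concavity the sine lies above its chord from \<open>0\<close> to
  \<open>pi / 2\<close>.\<close>

lemma sin_ge_linear:
  fixes x :: real
  assumes "0 \<le> x" "x \<le> pi / 2"
  shows "2 * x / pi \<le> sin x"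
proof -
  have "convex_on {0..pi/2} (\<lambda>x. - sin x)"
  proof (rule f''_ge0_imp_convex)
    fix x :: real assume x: "x \<in> {0..pi/2}"
    show "((\<lambda>x. - sin x) has_real_derivative - cos x) (at x)"
      by (auto intro!: derivative_eq_intros)
    show "((\<lambda>x. - cos x) has_real_derivative sin x) (at x)"
      by (auto intro!: derivative_eq_intros)
    show "0 \<le> sin x" using x by (intro sin_ge_zero) auto
  qed auto
  from convex_onD_Icc'[OF this, of x] assms show ?thesis
    by (simp add: field_simps)
qed

section \<open>Additive characters modulo \<open>N\<close>\<close>

definition unity_char :: "nat \<Rightarrow> int \<Rightarrow> complex" where
  "unity_char N t = exp (\<i> * of_real (2 * pi * real_of_int t / real N))"

lemma unity_char_add: "unity_char N (s + t) = unity_char N s * unity_char N t"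
  by (simp add: unity_char_def exp_add [symmetric] add_divide_distrib distrib_left)

lemma unity_char_0 [simp]: "unity_char N 0 = 1"
  by (simp add: unity_char_def)

lemma unity_char_power: "unity_char N (int k * t) = unity_char N t ^ k"
  by (induction k) (simp_all add: unity_char_add distrib_right)

lemma unity_char_sum: "finite A \<Longrightarrow> unity_char N (sum f A) = (\<Prod>i\<in>A. unity_char N (f i))"
  by (induction A rule: finite_induct) (simp_all add: unity_char_add)

lemma norm_unity_char [simp]: "norm (unity_char N t) = 1"
  unfolding unity_char_def by (rule norm_exp_i_times)

lemma unity_char_eq_1_iff:
  assumes "N > 0"
  shows "unity_char N t = 1 \<longleftrightarrow> int N dvd t"
proof -
  have "unity_char N t = 1 \<longleftrightarrow> (\<exists>n::int. 2 * pi * real_of_int t / real N = of_int (2 * n) * pi)"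
    by (simp add: unity_char_def exp_eq_1)
  also have "\<dots> \<longleftrightarrow> (\<exists>n::int. real_of_int t = real_of_int (int N * n))"
    using assms by (simp add: field_simps)
  also have "\<dots> \<longleftrightarrow> int N dvd t"
    by (simp only: of_int_eq_iff dvd_def)
  finally show ?thesis .
qed

text \<open>Orthogonality: unless \<open>N\<close> divides \<open>t\<close>, this is a full
  geometric sum of an \<open>N\<close>-th root of unity different from 1.\<close>

lemma sum_unity_char:
  assumes "N > 0"
  shows "(\<Sum>k<N. unity_char N (int k * t)) = (if int N dvd t then of_nat N else 0)"
proof (cases "int N dvd t")
  case True
  then have "unity_char N t = 1" using unity_char_eq_1_iff[OF assms] by blast
  then show ?thesis using True by (simp add: unity_char_power)
next
  case False
  then have "unity_char N t \<noteq> 1" using unity_char_eq_1_iff[OF assms] by simp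
  moreover have "unity_char N t ^ N = 1"
    using unity_char_eq_1_iff[OF assms] by (simp flip: unity_char_power)
  ultimately show ?thesis using False
    by (simp add: unity_char_power geometric_sum)
qed

lemma unity_char_mod:
  assumes "N > 0"
  shows "unity_char N (int h * int (x mod N)) = unity_char N (int h * int x)"
proof -
  have "unity_char N (int h * int x) = unity_char N (int h * int (x mod N) + int N * (int h * int (x div N)))"
    by (metis (no_types, opaque_lifting) distrib_left mod_mult_div_eq mult.left_commute of_nat_add of_nat_mult)
  then show ?thesis using unity_char_eq_1_iff[OF assms]
    by (simp add: unity_char_add)
qed

section \<open>Fourier coefficients of intervals\<close>

text \<open>The discrete Fourier coefficient at \<open>h\<close> of the indicator of
  \<open>{0..<a}\<close> on the cyclic group of order \<open>N\<close>.\<close>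

definition interval_coeff :: "nat \<Rightarrow> nat \<Rightarrow> nat \<Rightarrow> complex" where
  "interval_coeff N a h = (\<Sum>b<a. unity_char N (- int h * int b)) / of_nat N"

text \<open>Fourier inversion: after exchanging the sums, orthogonality retains only the term
  \<open>b = x mod N\<close>, which is present exactly if \<open>x mod N < a\<close>.\<close>

lemma interval_expansion:
  assumes "N > 0" "a \<le> N"
  shows "of_bool (x mod N < a) = (\<Sum>h<N. interval_coeff N a h * unity_char N (int h * int x))"
proof -
  define y where "y = x mod N"
  have y: "y < N" using assms by (simp add: y_def)
  have "(\<Sum>h<N. interval_coeff N a h * unity_char N (int h * int x))
      = (\<Sum>h<N. \<Sum>b<a. unity_char N (int h * (int y - int b)) / of_nat N)"
  proof (rule sum.cong[OF refl])
    fix h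
    have "unity_char N (- int h * int b) * unity_char N (int h * int x)
        = unity_char N (int h * (int y - int b))" for b
      unfolding unity_char_mod[OF assms(1), of h x, symmetric] y_def unity_char_add [symmetric]
      by (simp add: algebra_simps)
    then show "interval_coeff N a h * unity_char N (int h * int x)
        = (\<Sum>b<a. unity_char N (int h * (int y - int b)) / of_nat N)"
      by (simp add: interval_coeff_def sum_distrib_right sum_divide_distrib del: mult_minus_left)
  qed
  also have "\<dots> = (\<Sum>b<a. (\<Sum>h<N. unity_char N (int h * (int y - int b))) / of_nat N)"
    by (subst sum.swap) (simp add: sum_divide_distrib)
  also have "\<dots> = (\<Sum>b<a. if b = y then 1 else 0)"
  proof (rule sum.cong[OF refl])
    fix b assume "b \<in> {..<a}"
    then have "\<bar>int y - int b\<bar> < int N" using y assms by auto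
    then have "int N dvd (int y - int b) \<longleftrightarrow> b = y"
      using dvd_imp_le_int[of "int y - int b" "int N"] by auto
    then show "(\<Sum>h<N. unity_char N (int h * (int y - int b))) / of_nat N = (if b = y then 1 else 0)"
      using assms by (simp add: sum_unity_char)
  qed
  also have "\<dots> = of_bool (y < a)" by simp
  finally show ?thesis by (simp add: y_def)
qed

text \<open>The coefficient at \<open>h \<noteq> 0\<close> is at most \<open>1 / (2 min h (N - h))\<close>. Replacing the reciprocal
  minimum by the sum of both reciprocals makes the total a harmonic sum.\<close>

definition frequency_weight :: "nat \<Rightarrow> nat \<Rightarrow> real" where
  "frequency_weight N h = (if h = 0 then 1 else (1 / real h + 1 / real (N - h)) / 2)"

lemma frequency_weight_nonneg: "frequency_weight N h \<ge> 0"
  by (simp add: frequency_weight_def)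

text \<open>For \<open>h \<noteq> 0\<close> the coefficient is a geometric sum over
  \<open>N\<close>. Its numerator is at most 2, and its denominator has modulus
  \<open>2 * sin (pi * h / N)\<close>, which Jordan's inequality bounds from below.\<close>

lemma norm_interval_coeff_le:
  assumes "N > 0" "a \<le> N" "h < N"
  shows "norm (interval_coeff N a h) \<le> frequency_weight N h"
proof (cases "h = 0")
  case True
  then show ?thesis using assms by (simp add: interval_coeff_def frequency_weight_def norm_divide)
next
  case False
  define z where "z = unity_char N (- int h)"
  have "\<not> int N dvd - int h" using False assms by (auto dest: zdvd_imp_le)
  then have z1: "z \<noteq> 1" using unity_char_eq_1_iff[OF assms(1)] by (simp add: z_def)
  \<comment> \<open>The distance from \<open>h\<close> to the nearest multiple of \<open>N\<close>.
    Symmetry of the sine about \<open>pi / 2\<close> allows passing to it, and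
    \<open>pi * m / N\<close> lies in the range of Jordan's inequality.\<close>
  define m where "m = min h (N - h)"
  have m: "m > 0" using False assms by (simp add: m_def)
  have sin: "2 * real m / real N \<le> sin (pi * real h / real N)"
  proof -
    have "sin (pi * real h / real N) = sin (pi * real m / real N)"
    proof (cases "h \<le> N - h")
      case False
      then have "pi * real m / real N = pi - pi * real h / real N"
        using assms by (simp add: m_def of_nat_diff field_simps)
      then show ?thesis by (simp only: sin_pi_minus)
    qed (simp add: m_def)
    moreover have "pi * real m / real N \<le> pi / 2"
    proof -
      have "2 * real m \<le> real N" by (simp add: m_def)
      then show ?thesis using assms by (simp add: field_simps)
    qed
    ultimately show ?thesis using sin_ge_linear[of "pi * real m / real N"] by simp
  qed
  have "norm (z - 1) = 2 * \<bar>sin (pi * real h / real N)\<bar>"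
    using dist_exp_i_1[of "2 * pi * real_of_int (- int h) / real N"]
    by (simp add: z_def unity_char_def)
  with sin have nz: "norm (z - 1) \<ge> 4 * real m / real N" by simp
  have "(\<Sum>b<a. unity_char N (- int h * int b)) = (\<Sum>b<a. z ^ b)"
    by (simp add: z_def flip: unity_char_power) (simp add: mult.commute)
  also have "\<dots> = (z ^ a - 1) / (z - 1)" using z1 by (rule geometric_sum)
  finally have "norm (interval_coeff N a h) = norm (z ^ a - 1) / norm (z - 1) / real N"
    by (simp add: interval_coeff_def norm_divide norm_mult)
  also have "\<dots> \<le> 2 / norm (z - 1) / real N"
    using norm_triangle_ineq4[of "z ^ a" 1] by (intro divide_right_mono) (auto simp: norm_power z_def)
  also have "\<dots> \<le> 2 / (4 * real m / real N) / real N"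
    using nz m assms by (intro divide_right_mono divide_left_mono) (auto intro!: mult_pos_pos simp: z1)
  also have "\<dots> = 1 / real m / 2" using assms by simp
  also have "1 / real m \<le> 1 / real h + 1 / real (N - h)"
    by (auto simp: m_def min_def)
  finally show ?thesis using False by (simp add: frequency_weight_def)
qed

lemma sum_frequency_weight:
  assumes "N \<ge> 2"
  shows "(\<Sum>h<N. frequency_weight N h) \<le> 4 * ln (real N)"
proof -
  have "(\<Sum>h<N. frequency_weight N h) = 1 + (\<Sum>h=1..<N. (1 / real h + 1 / real (N - h)) / 2)"
    using assms by (simp add: lessThan_atLeast0 sum.atLeast_Suc_lessThan frequency_weight_def)
  also have "(\<Sum>h=1..<N. (1 / real h + 1 / real (N - h)) / 2)
      = ((\<Sum>h=1..<N. 1 / real h) + (\<Sum>h=1..<N. 1 / real (N - h))) / 2"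
    by (simp add: sum.distrib flip: sum_divide_distrib)
  also have "(\<Sum>h=1..<N. 1 / real (N - h)) = (\<Sum>h=1..<N. 1 / real h)"
    by (rule sum.reindex_bij_witness[of _ "\<lambda>h. N - h" "\<lambda>h. N - h"]) auto
  also have "((\<Sum>h=1..<N. 1 / real h) + (\<Sum>h=1..<N. 1 / real h)) / 2 = harm (N - 1)"
  proof -
    have "{1..<N} = {1..N - 1}" using assms by auto
    then show ?thesis by (simp add: harm_def inverse_eq_divide)
  qed
  \<comment> \<open>The sequence \<open>harm (k + 1) - ln (k + 1)\<close> decreases from its initial
    value 1.\<close>
  also have "harm (N - 1) \<le> 1 + ln (real (N - 1))"
    using decseqD[OF decseq_harm_diff_ln, of 0 "N - 2"] assms
    by (simp add: harm_def numeral_2_eq_2 Suc_diff_Suc)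
  also have "ln (real (N - 1)) \<le> ln (real N)" using assms by simp
  finally have "(\<Sum>h<N. frequency_weight N h) \<le> 2 + ln (real N)" by simp
  \<comment> \<open>Since \<open>ln N \<ge> 2 / 3\<close>, the constant 2 is at most
    \<open>3 * ln N\<close>; hence the factor 4.\<close>
  moreover have "ln (real N) \<ge> ln 2" using assms by simp
  moreover have "ln 2 \<ge> (2/3 :: real)" by (rule ln2_ge_two_thirds)
  ultimately show ?thesis by simp
qed

section \<open>Sums over the dual lattice\<close>

text \<open>A variant of Niederreiter's figure of merit \<open>R(g, N)\<close>, over the nonzero
  dual vectors modulo \<open>N\<close>. As \<open>frequency_weight\<close> is invariant under
  \<open>h \<mapsto> N - h\<close> for \<open>0 < h < N\<close>, representatives in
  \<open>{0..<N}\<close> serve as well as signed ones.\<close>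

definition dual_sum :: "nat \<Rightarrow> ('d::finite \<Rightarrow> nat) \<Rightarrow> real" where
  "dual_sum N g = (\<Sum>h\<in>{h \<in> UNIV \<rightarrow>\<^sub>E {..<N}. h \<noteq> (\<lambda>_. 0) \<and> N dvd (\<Sum>i\<in>UNIV. h i * g i)}.
      \<Prod>i\<in>UNIV. frequency_weight N (h i))"

lemma dual_sum_nonneg: "dual_sum N g \<ge> 0"
  unfolding dual_sum_def by (intro sum_nonneg prod_nonneg) (auto simp: frequency_weight_nonneg)

text \<open>Expand the indicator in each coordinate, multiply out and sum over \<open>k\<close>:
  orthogonality leaves the frequencies dual to \<open>g\<close>. The zero frequency is exactly the
  expected proportion, and the others are bounded termwise.\<close>

lemma count_minus_expected_le_dual_sum:
  fixes g a :: "'d::finite \<Rightarrow> nat"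
  assumes N: "N > 0" and a: "\<And>i. a i \<le> N"
  shows "\<bar>real (card {k \<in> {..<N}. \<forall>i. (k * g i) mod N < a i}) / real N - (\<Prod>i\<in>UNIV. real (a i) / real N)\<bar>
    \<le> dual_sum N g"
proof -
  let ?H = "UNIV \<rightarrow>\<^sub>E {..<N} :: ('d \<Rightarrow> nat) set"
  let ?Z = "\<lambda>h. N dvd (\<Sum>i\<in>UNIV. h i * g i)"
  let ?c = "\<lambda>h. \<Prod>i\<in>UNIV. interval_coeff N (a i) (h i)"
  have fin: "finite ?H" by (intro finite_PiE) auto
  have "complex_of_nat (card {k \<in> {..<N}. \<forall>i. (k * g i) mod N < a i})
      = (\<Sum>k<N. of_bool (\<forall>i. (k * g i) mod N < a i))"
    by (simp add: sum.If_cases of_bool_def Int_def)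
  also have "\<dots> = (\<Sum>k<N. \<Prod>i\<in>UNIV. of_bool ((k * g i) mod N < a i))"
  proof (rule sum.cong[OF refl])
    fix k
    show "of_bool (\<forall>i. (k * g i) mod N < a i) = (\<Prod>i\<in>UNIV. of_bool ((k * g i) mod N < a i) :: complex)"
      by (cases "\<forall>i. (k * g i) mod N < a i") (auto intro!: prod_zero)
  qed
  also have "\<dots> = (\<Sum>k<N. \<Prod>i\<in>UNIV. \<Sum>h<N. interval_coeff N (a i) h * unity_char N (int h * int (k * g i)))"
    using interval_expansion[OF N a] by simp
  also have "\<dots> = (\<Sum>k<N. \<Sum>h\<in>?H. \<Prod>i\<in>UNIV. interval_coeff N (a i) (h i) * unity_char N (int (h i) * int (k * g i)))"
    by (subst prod_sum_PiE) auto
  also have "\<dots> = (\<Sum>k<N. \<Sum>h\<in>?H. ?c h * unity_char N (int k * int (\<Sum>i\<in>UNIV. h i * g i)))"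
    by (simp add: prod.distrib unity_char_sum [symmetric] sum_distrib_left mult_ac)
  also have "\<dots> = (\<Sum>h\<in>?H. ?c h * (\<Sum>k<N. unity_char N (int k * int (\<Sum>i\<in>UNIV. h i * g i))))"
    by (subst sum.swap) (simp add: sum_distrib_left)
  also have "\<dots> = (\<Sum>h\<in>?H. if ?Z h then of_nat N * ?c h else 0)"
    by (rule sum.cong[OF refl]) (simp only: sum_unity_char[OF N] int_dvd_int_iff, simp)
  also have "\<dots> = of_nat N * (\<Sum>h\<in>{h\<in>?H. ?Z h}. ?c h)"
    unfolding sum_distrib_left sum.inter_filter[OF fin] by (intro sum.cong) auto
  also have "{h\<in>?H. ?Z h} = insert (\<lambda>_. 0) {h\<in>?H. h \<noteq> (\<lambda>_. 0) \<and> ?Z h}"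
    using N by auto
  also have "(\<Sum>h\<in>\<dots>. ?c h) = ?c (\<lambda>_. 0) + (\<Sum>h\<in>{h\<in>?H. h \<noteq> (\<lambda>_. 0) \<and> ?Z h}. ?c h)"
    using fin by (subst sum.insert) auto
  also have "?c (\<lambda>_. 0) = of_real (\<Prod>i\<in>UNIV. real (a i) / real N)"
    by (simp add: interval_coeff_def)
  finally have expansion: "complex_of_real (real (card {k \<in> {..<N}. \<forall>i. (k * g i) mod N < a i}) / real N
        - (\<Prod>i\<in>UNIV. real (a i) / real N))
      = (\<Sum>h\<in>{h\<in>?H. h \<noteq> (\<lambda>_. 0) \<and> ?Z h}. ?c h)"
    using N by simp
  have "\<bar>real (card {k \<in> {..<N}. \<forall>i. (k * g i) mod N < a i}) / real N
        - (\<Prod>i\<in>UNIV. real (a i) / real N)\<bar> = norm (\<Sum>h\<in>{h\<in>?H. h \<noteq> (\<lambda>_. 0) \<and> ?Z h}. ?c h)"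
    unfolding expansion [symmetric] by (simp only: norm_of_real)
  also have "\<dots> \<le> dual_sum N g"
    unfolding dual_sum_def
  proof (rule sum_norm_le)
    fix h assume "h \<in> {h\<in>?H. h \<noteq> (\<lambda>_. 0) \<and> ?Z h}"
    then have "h i < N" for i by auto
    then show "norm (?c h) \<le> (\<Prod>i\<in>UNIV. frequency_weight N (h i))"
      unfolding prod_norm [symmetric] by (intro prod_mono) (auto intro!: norm_interval_coeff_le N a)
  qed
  finally show ?thesis .
qed

text \<open>At an index with \<open>h i \<noteq> 0\<close>, the other coordinates of
  \<open>g\<close> determine \<open>g i\<close> modulo \<open>N\<close>, so deleting that coordinate
  is injective.\<close>

lemma card_orthogonal_le:
  fixes h :: "'d::finite \<Rightarrow> nat"
  assumes N: "prime N" and h: "h \<in> UNIV \<rightarrow>\<^sub>E {..<N}" "h \<noteq> (\<lambda>_. 0)"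
  shows "card {g \<in> UNIV \<rightarrow>\<^sub>E {1..<N}. N dvd (\<Sum>i\<in>UNIV. h i * g i)} \<le> (N - 1) ^ (CARD('d) - 1)"
proof -
  let ?S = "{g \<in> UNIV \<rightarrow>\<^sub>E {1..<N}. N dvd (\<Sum>i\<in>UNIV. h i * g i)}"
  obtain i where i: "h i \<noteq> 0" using h(2) by auto
  have "h i < N" using h(1) by auto
  with i have hi: "\<not> int N dvd int (h i)" by (auto dest: nat_dvd_not_less)
  have "inj_on (\<lambda>g. restrict g (- {i})) ?S"
  proof (rule inj_onI)
    fix g g' assume g: "g \<in> ?S" "g' \<in> ?S" and eq: "restrict g (- {i}) = restrict g' (- {i})"
    have off: "g j = g' j" if "j \<noteq> i" for j
      using fun_cong[OF eq, of j] that by simp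
    have "int N dvd int (\<Sum>j\<in>UNIV. h j * g j)" "int N dvd int (\<Sum>j\<in>UNIV. h j * g' j)"
      using g by (simp_all only: int_dvd_int_iff mem_Collect_eq)
    then have "int N dvd int (\<Sum>j\<in>UNIV. h j * g j) - int (\<Sum>j\<in>UNIV. h j * g' j)"
      by (rule dvd_diff)
    also have "(\<Sum>j\<in>UNIV. h j * g j) = h i * g i + (\<Sum>j\<in>UNIV - {i}. h j * g' j)"
      by (subst sum.remove[of _ i]) (auto simp: off)
    also have "(\<Sum>j\<in>UNIV. h j * g' j) = h i * g' i + (\<Sum>j\<in>UNIV - {i}. h j * g' j)"
      by (subst sum.remove[of _ i]) auto
    finally have "int N dvd int (h i) * (int (g i) - int (g' i))"
      by (simp add: right_diff_distrib)
    moreover have "g i < N" "g' i < N" using g by (auto simp: PiE_iff)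
    ultimately have "g i = g' i" using prime_cancel_residue[OF N hi] by blast
    with off show "g = g'" by (metis ext)
  qed
  then have "card ?S \<le> card ((- {i}) \<rightarrow>\<^sub>E {1..<N})"
    by (rule card_inj_on_le)
      (auto intro!: finite_PiE simp: image_subset_iff restrict_PiE_iff PiE_iff)
  also have "\<dots> = (N - 1) ^ (CARD('d) - 1)"
    by (simp add: card_funcsetE Compl_eq_Diff_UNIV card_Diff_subset)
  finally show ?thesis .
qed

text \<open>Exchange the sums and count the generators orthogonal to each \<open>h\<close>.
  Admitting \<open>h = 0\<close> only enlarges the bound, and the product weights summed over all
  \<open>h\<close> factor into a power of the one-dimensional sum.\<close>

lemma sum_dual_sum_le:
  assumes N: "prime N"
  shows "(\<Sum>g\<in>(UNIV \<rightarrow>\<^sub>E {1..<N} :: ('d::finite \<Rightarrow> nat) set). dual_sum N g)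
    \<le> real (N - 1) ^ (CARD('d) - 1) * (4 * ln (real N)) ^ CARD('d)"
proof -
  let ?G = "UNIV \<rightarrow>\<^sub>E {1..<N} :: ('d \<Rightarrow> nat) set"
  let ?H = "UNIV \<rightarrow>\<^sub>E {..<N} :: ('d \<Rightarrow> nat) set"
  let ?R = "\<lambda>g h. h \<noteq> (\<lambda>_. 0) \<and> N dvd (\<Sum>i\<in>UNIV. h i * g i)"
  let ?w = "\<lambda>h. \<Prod>i\<in>UNIV. frequency_weight N (h i)"
  have w0: "?w h \<ge> 0" for h by (intro prod_nonneg) (auto simp: frequency_weight_nonneg)
  have fin: "finite ?G" "finite ?H" by (auto intro!: finite_PiE)
  have "(\<Sum>g\<in>?G. dual_sum N g) = (\<Sum>h\<in>?H. \<Sum>g\<in>{g \<in> ?G. ?R g h}. ?w h)"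
    unfolding dual_sum_def by (rule sum.swap_restrict[OF fin])
  also have "\<dots> = (\<Sum>h\<in>?H. real (card {g \<in> ?G. ?R g h}) * ?w h)" by simp
  also have "\<dots> \<le> (\<Sum>h\<in>?H. real ((N - 1) ^ (CARD('d) - 1)) * ?w h)"
  proof (intro sum_mono mult_right_mono w0 of_nat_mono)
    fix h assume "h \<in> ?H"
    then show "card {g \<in> ?G. ?R g h} \<le> (N - 1) ^ (CARD('d) - 1)"
      using card_orthogonal_le[OF N, of h] by (cases "h = (\<lambda>_. 0)") simp_all
  qed
  also have "\<dots> = real (N - 1) ^ (CARD('d) - 1) * (\<Sum>h<N. frequency_weight N h) ^ CARD('d)"
  proof -
    have "(\<Sum>h\<in>?H. ?w h) = (\<Sum>h<N. frequency_weight N h) ^ CARD('d)"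
      using prod_sum_PiE[of "UNIV :: 'd set" "\<lambda>_. {..<N}" "\<lambda>_. frequency_weight N"] by simp
    then show ?thesis by (simp only: sum_distrib_left [symmetric] of_nat_power)
  qed
  also have "\<dots> \<le> real (N - 1) ^ (CARD('d) - 1) * (4 * ln (real N)) ^ CARD('d)"
    using prime_ge_2_nat[OF N]
    by (intro mult_left_mono power_mono sum_frequency_weight sum_nonneg frequency_weight_nonneg) auto
  finally show ?thesis .
qed

subsection \<open>Geometry of the lattice point sets\<close>

lemma unit_cube_nonempty: "(cbox 0 1 :: (real ^ 'd) set) \<noteq> {}"
proof -
  have "(0 :: real ^ 'd) \<in> cbox 0 1" by (simp add: mem_box_cart)
  then show ?thesis by blast
qed

lemma infnorm_le_cart:
  fixes x :: "real ^ 'd"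
  assumes "\<And>i. \<bar>x $ i\<bar> \<le> r"
  shows "infnorm x \<le> r"
  unfolding infnorm_cart by (rule cSup_least) (use assms in auto)

text \<open>Reduces every exponent to the maximum norm. The factor \<open>d ^ (1 / p)\<close> is
  relaxed to \<open>d\<close>, which also covers \<open>p = \<infinity>\<close>.\<close>

lemma lp_norm_bounds:
  fixes x :: "real ^ 'd"
  assumes "p \<in> {1..\<infinity>}"
  shows "infnorm x \<le> lp_norm p x" "lp_norm p x \<le> real CARD('d) * infnorm x"
proof -
  have card1: "real CARD('d) \<ge> 1" by (simp add: Suc_leI)
  have "infnorm x \<le> lp_norm p x \<and> lp_norm p x \<le> real CARD('d) * infnorm x"
  proof (cases "p = \<infinity>")
    case True
    then show ?thesis
      using mult_right_mono[OF card1, of "infnorm x"] by (simp add: lp_norm_def infnorm_pos_le)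
  next
    case False
    define r where "r = real_of_ereal p"
    have r: "r \<ge> 1" using assms False by (cases p) (auto simp: r_def)
    define S where "S = (\<Sum>i\<in>UNIV. \<bar>x $ i\<bar> powr r)"
    have lp: "lp_norm p x = S powr (1 / r)"
      using False by (simp add: lp_norm_def S_def r_def)
    have "\<bar>x $ i\<bar> \<le> S powr (1 / r)" for i
    proof -
      have "\<bar>x $ i\<bar> powr r \<le> S" unfolding S_def by (rule member_le_sum) auto
      then have "(\<bar>x $ i\<bar> powr r) powr (1 / r) \<le> S powr (1 / r)"
        using r by (intro powr_mono2) auto
      then show ?thesis using r by (simp add: powr_powr)
    qed
    then have "infnorm x \<le> S powr (1 / r)" by (rule infnorm_le_cart)
    moreover have "S powr (1 / r) \<le> real CARD('d) * infnorm x"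
    proof -
      have "S \<le> (\<Sum>i\<in>(UNIV :: 'd set). infnorm x powr r)"
        unfolding S_def using r by (intro sum_mono powr_mono2 component_le_infnorm_cart) auto
      then have "S powr (1 / r) \<le> (real CARD('d) * infnorm x powr r) powr (1 / r)"
        using r by (intro powr_mono2) (auto simp: S_def intro!: sum_nonneg)
      also have "\<dots> = real CARD('d) powr (1 / r) * infnorm x"
        using r by (simp add: powr_mult powr_powr infnorm_pos_le)
      also have "\<dots> \<le> real CARD('d) powr 1 * infnorm x"
        using r card1 by (intro mult_right_mono powr_mono) (auto simp: infnorm_pos_le)
      finally show ?thesis by simp
    qed
    ultimately show ?thesis by (simp add: lp)
  qed
  then show "infnorm x \<le> lp_norm p x" "lp_norm p x \<le> real CARD('d) * infnorm x" by auto
qed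

text \<open>The comparison of norms costs the factor \<open>d\<close> in the covering radius only,
  since the maximum norm bounds the others from below. The distinct points \<open>a\<close> and
  \<open>b\<close> ensure that the separation radius is a minimum over a nonempty set.\<close>

lemma mesh_ratio_le:
  fixes P :: "(real ^ 'd) set"
  assumes p: "p \<in> {1..\<infinity>}" and P: "finite P" "a \<in> P" "b \<in> P" "a \<noteq> b"
    and cover: "\<And>x. x \<in> cbox 0 1 \<Longrightarrow> \<exists>y\<in>P. infnorm (x - y) \<le> R"
    and sep: "\<And>x y. x \<in> P \<Longrightarrow> y \<in> P \<Longrightarrow> x \<noteq> y \<Longrightarrow> r \<le> infnorm (x - y)"
    and r: "r > 0"
  shows "mesh_ratio p P \<le> real CARD('d) * R / (r / 2)"
proof -
  have ne: "(cbox 0 1 :: (real ^ 'd) set) \<noteq> {}"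
    by (rule unit_cube_nonempty)
  have "covering_radius p P \<le> real CARD('d) * R"
    unfolding covering_radius_def
  proof (rule cSUP_least[OF ne])
    fix x :: "real ^ 'd" assume "x \<in> cbox 0 1"
    then obtain y where y: "y \<in> P" "infnorm (x - y) \<le> R" using cover by blast
    have "Min ((\<lambda>y. lp_norm p (x - y)) ` P) \<le> lp_norm p (x - y)" using y P by (intro Min_le) auto
    also have "\<dots> \<le> real CARD('d) * infnorm (x - y)" by (rule lp_norm_bounds(2)[OF p])
    also have "\<dots> \<le> real CARD('d) * R" using y by (intro mult_left_mono) auto
    finally show "Min ((\<lambda>y. lp_norm p (x - y)) ` P) \<le> real CARD('d) * R" .
  qed
  moreover have "r / 2 \<le> separation_radius p P"
  proof -
    let ?S = "{lp_norm p (x - y) | x y. x \<in> P \<and> y \<in> P \<and> x \<noteq> y}"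
    have "?S \<subseteq> (\<lambda>(x, y). lp_norm p (x - y)) ` (P \<times> P)" by auto
    then have "finite ?S" by (rule finite_subset) (use P in auto)
    moreover have "?S \<noteq> {}" using P by blast
    moreover have "r \<le> z" if "z \<in> ?S" for z
      using that sep lp_norm_bounds(1)[OF p] by (auto intro: order.trans)
    ultimately have "r \<le> Min ?S" by (intro Min.boundedI)
    then show ?thesis by (simp add: separation_radius_def)
  qed
  moreover have "R \<ge> 0"
  proof -
    obtain x :: "real ^ 'd" where "x \<in> cbox 0 1" using ne by blast
    then show ?thesis using cover[of x] infnorm_pos_le order.trans by blast
  qed
  ultimately show ?thesis
    unfolding mesh_ratio_def using r by (intro frac_le) auto
qed

text \<open>Indexed by \<open>k\<close> and written with residues in place of \<open>frac\<close>,
  so that congruences apply.\<close>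

definition lattice_point :: "nat \<Rightarrow> nat ^ 'd \<Rightarrow> nat \<Rightarrow> real ^ 'd" where
  "lattice_point N g k = (\<chi> i. real ((k * g $ i) mod N) / real N)"

lemma lattice_points_eq:
  assumes "N > 0"
  shows "lattice_points g N = lattice_point N g ` {..<N}"
proof -
  have "frac (real k / real N * real x) = real ((k * x) mod N) / real N" for k x
  proof -
    have "frac (real k / real N * real x) = real (k * x) / real N - \<lfloor>real (k * x) / real N\<rfloor>"
      by (simp add: frac_def)
    also have "\<dots> = real ((k * x) mod N) / real N"
    proof -
      have "real (k * x) = real N * real (k * x div N) + real (k * x mod N)"
        by (metis mult_div_mod_eq of_nat_add of_nat_mult)
      then show ?thesis
        using assms unfolding floor_divide_of_nat_eq by (simp add: field_simps del: of_nat_mult)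
    qed
    finally show ?thesis .
  qed
  moreover have "{0..N - 1} = {..<N}" using assms by auto
  ultimately show ?thesis by (simp add: lattice_points_def lattice_point_def cong: image_cong)
qed

text \<open>A single coordinate suffices, as every \<open>g $ i\<close> is invertible modulo the
  prime \<open>N\<close>. Hence the point set has exactly \<open>N\<close> elements.\<close>

lemma inj_on_lattice_point:
  fixes g :: "nat ^ 'd"
  assumes N: "prime N" and g: "g \<in> generators N"
  shows "inj_on (lattice_point N g) {..<N}"
proof (rule inj_onI)
  fix k l assume kl: "k \<in> {..<N}" "l \<in> {..<N}" and eq: "lattice_point N g k = lattice_point N g l"
  fix i :: 'd
  have "lattice_point N g k $ i = lattice_point N g l $ i" using eq by simp
  then have "(k * g $ i) mod N = (l * g $ i) mod N"
    using prime_gt_0_nat[OF N] by (simp add: lattice_point_def)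
  then have "int N dvd int (k * g $ i) - int (l * g $ i)"
    by (metis mod_eq_dvd_iff of_nat_mod)
  then have "int N dvd int (g $ i) * (int k - int l)" by (simp add: algebra_simps)
  moreover have "g $ i \<in> {1..N - 1}" using g by (simp add: generators_def)
  then have "0 < g $ i" "g $ i < N" using prime_gt_0_nat[OF N] by auto
  then have "\<not> int N dvd int (g $ i)" by (auto dest: nat_dvd_not_less)
  ultimately show "k = l" using prime_cancel_residue[OF N] kl by blast
qed

text \<open>Up to an integer vector, and for \<open>l < k\<close>, the difference is the point with
  index \<open>k - l\<close>; \<open>sep\<close> keeps some coordinate of that point away from both
  0 and 1.\<close>

lemma infnorm_lattice_point_diff:
  fixes g :: "nat ^ 'd"
  assumes N: "N > 0" and sep: "\<forall>k\<in>{1..<N}. \<exists>i. r < real ((k * g $ i) mod N) \<and> r < real N - real ((k * g $ i) mod N)"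
    and kl: "k < N" "l < N" "k \<noteq> l"
  shows "r / real N \<le> infnorm (lattice_point N g k - lattice_point N g l)"
proof -
  have *: "r / real N \<le> infnorm (lattice_point N g k - lattice_point N g l)" if kl: "l < k" "k < N" for k l
  proof -
    have "k - l \<in> {1..<N}" using kl by auto
    then obtain i where i: "r < real (((k - l) * g $ i) mod N)" "r < real N - real (((k - l) * g $ i) mod N)"
      using sep by blast
    define z where "z = ((k - l) * g $ i) mod N"
    define a where "a = (k * g $ i) mod N"
    define b where "b = (l * g $ i) mod N"
    have ab: "a < N" "b < N" "z < N" using N by (auto simp: a_def b_def z_def)
    have "[z + b = (k - l) * g $ i + l * g $ i] (mod N)"
      unfolding z_def b_def by (intro cong_add) (auto simp: cong_def)
    also have "(k - l) * g $ i + l * g $ i = k * g $ i"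
      using kl by (simp flip: add_mult_distrib)
    finally have "(z + b) mod N = a" by (simp add: cong_def a_def)
    \<comment> \<open>The distance between \<open>a\<close> and \<open>b\<close> is \<open>z\<close>
      without wrap-around and \<open>N - z\<close> with it; the two inequalities in
      \<open>sep\<close> treat these two cases.\<close>
    then have "z + b = a \<or> z + b = a + N"
      using ab by (cases "z + b < N") (auto simp: mod_if)
    then have "r \<le> \<bar>real a - real b\<bar>" using i unfolding z_def [symmetric] by linarith
    then have "r / real N \<le> \<bar>(lattice_point N g k - lattice_point N g l) $ i\<bar>"
      using N by (simp add: lattice_point_def a_def b_def abs_divide divide_right_mono flip: diff_divide_distrib)
    also have "\<dots> \<le> infnorm (lattice_point N g k - lattice_point N g l)"
      by (rule component_le_infnorm_cart)
    finally show ?thesis .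
  qed
  show ?thesis
  proof (cases "l < k")
    case True
    then show ?thesis using * kl by blast
  next
    case False
    then show ?thesis using *[of k l] kl by (simp add: infnorm_sub[of "lattice_point N g k"])
  qed
qed

text \<open>The centre \<open>c\<close> is within \<open>m\<close> of \<open>N x\<close>, and the
  covering property gives a multiple of \<open>g\<close> within \<open>m\<close> of
  \<open>c\<close>; divide by \<open>N\<close>.\<close>

lemma exists_lattice_point_near:
  fixes g :: "nat ^ 'd" and x :: "real ^ 'd"
  assumes cov: "box_covering N m (($) g)" and m: "1 \<le> m" "2 * m \<le> N" and x: "x \<in> cbox 0 1"
  shows "\<exists>k<N. infnorm (x - lattice_point N g k) \<le> 2 * real m / real N"
proof -
  have N: "N > 0" using m by auto
  have x01: "0 \<le> x $ i" "x $ i \<le> 1" for i using x by (auto simp: mem_box_cart)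
  \<comment> \<open>Centres are clamped into \<open>[m, N - m]\<close>, so that the box around them does not wrap around
    the torus.\<close>
  define c where "c i = min (N - m) (max m (nat \<lfloor>x $ i * real N\<rfloor>))" for i
  have c: "m \<le> c i" "c i \<le> N - m" for i using m by (auto simp: c_def)
  have c_near: "\<bar>x $ i * real N - real (c i)\<bar> \<le> real m" for i
  proof -
    define f where "f = nat \<lfloor>x $ i * real N\<rfloor>"
    have z: "0 \<le> x $ i * real N" "x $ i * real N \<le> real N"
      using x01[of i] by (auto simp: mult_left_le_one_le)
    have f: "real f \<le> x $ i * real N" "x $ i * real N < real f + 1"
      using z(1) unfolding f_def by linarith+
    have "c i = m \<and> f \<le> m \<or> c i = N - m \<and> N - m \<le> f \<or> c i = f"
      using m by (auto simp: c_def f_def [symmetric])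
    moreover have "real (N - m) = real N - real m" "N - m \<le> f \<Longrightarrow> real N - real m \<le> real f"
      using m by (auto simp: of_nat_diff)
    ultimately show ?thesis using z f m by fastforce
  qed
  obtain j where j: "j < N" "\<And>i. \<exists>s<m. \<exists>t<m. [j * g $ i + s = c i + t] (mod N)"
    using cov unfolding box_covering_def by blast
  have "\<bar>(x - lattice_point N g j) $ i\<bar> \<le> 2 * real m / real N" for i
  proof -
    obtain s t where st: "s < m" "t < m" "[j * g $ i + s = c i + t] (mod N)" using j by blast
    \<comment> \<open>The subtraction is exact because \<open>s < m \<le> c i\<close>, and
      \<open>t < m\<close> with \<open>c i \<le> N - m\<close> keeps the result below
      \<open>N\<close>, so it is the residue itself.\<close>
    have "[j * g $ i + s = (c i + t - s) + s] (mod N)" using st c[of i] by simp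
    then have "[j * g $ i = c i + t - s] (mod N)" by (simp only: cong_add_rcancel_nat)
    moreover have "c i + t - s < N" using st c[of i] m by linarith
    ultimately have eq: "(j * g $ i) mod N = c i + t - s" by (simp add: cong_def)
    have "real (c i + t - s) = real (c i) + real t - real s" using st c[of i] by (simp add: of_nat_diff)
    then have "\<bar>x $ i * real N - real ((j * g $ i) mod N)\<bar> \<le> 2 * real m"
      using c_near[of i] st unfolding eq by linarith
    then have "\<bar>x $ i * real N - real ((j * g $ i) mod N)\<bar> / real N \<le> 2 * real m / real N"
      by (intro divide_right_mono) auto
    moreover have "(x - lattice_point N g j) $ i = (x $ i * real N - real ((j * g $ i) mod N)) / real N"
      using N by (simp add: lattice_point_def field_simps)
    ultimately show ?thesis by (simp add: abs_divide)
  qed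
  then show ?thesis using j by (blast intro: infnorm_le_cart)
qed

text \<open>Rounding the corner of the box up to multiples of \<open>1 / N\<close> leaves the count
  unchanged, because the points lie on that grid, and changes the volume by at most
  \<open>d / N\<close>.\<close>

lemma star_discrepancy_le:
  fixes g :: "nat ^ 'd"
  assumes N: "prime N" and g: "g \<in> generators N"
  shows "star_discrepancy (lattice_points g N) \<le> dual_sum N (($) g) + real CARD('d) / real N"
proof -
  have N0: "N > 0" using prime_gt_0_nat[OF N] .
  have inj: "inj_on (lattice_point N g) {..<N}" by (rule inj_on_lattice_point[OF N g])
  have P: "lattice_points g N = lattice_point N g ` {..<N}" by (rule lattice_points_eq[OF N0])
  have cardP: "card (lattice_points g N) = N" by (simp add: P card_image[OF inj])
  have ne: "(cbox 0 1 :: (real ^ 'd) set) \<noteq> {}"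
    by (rule unit_cube_nonempty)
  show ?thesis
    unfolding star_discrepancy_def
  proof (rule cSUP_least[OF ne])
    fix \<alpha> :: "real ^ 'd" assume "\<alpha> \<in> cbox 0 1"
    then have \<alpha>: "0 \<le> \<alpha> $ i" "\<alpha> $ i \<le> 1" for i by (auto simp: mem_box_cart)
    define a where "a i = nat \<lceil>\<alpha> $ i * real N\<rceil>" for i
    have \<alpha>N: "0 \<le> \<alpha> $ i * real N" "\<alpha> $ i * real N \<le> real N" for i
      using \<alpha>[of i] by (auto simp: mult_left_le_one_le)
    have a_le: "a i \<le> N" for i
      using \<alpha>N(2)[of i] by (simp add: a_def nat_le_iff ceiling_le_iff)
    have less_a: "real x / real N < \<alpha> $ i \<longleftrightarrow> x < a i" for x i
    proof -
      have "real x / real N < \<alpha> $ i \<longleftrightarrow> real x < \<alpha> $ i * real N" using N0 by (simp add: field_simps)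
      also have "\<dots> \<longleftrightarrow> int x < \<lceil>\<alpha> $ i * real N\<rceil>" by (simp add: less_ceiling_iff)
      finally show ?thesis by (auto simp: a_def zless_nat_eq_int_zless)
    qed
    let ?K = "{k \<in> {..<N}. \<forall>i. (k * g $ i) mod N < a i}"
    have "lattice_points g N \<inter> {x. \<forall>i. 0 \<le> x $ i \<and> x $ i < \<alpha> $ i} = lattice_point N g ` ?K"
      unfolding P by (auto simp: lattice_point_def less_a)
    then have count: "card (lattice_points g N \<inter> {x. \<forall>i. 0 \<le> x $ i \<and> x $ i < \<alpha> $ i}) = card ?K"
      by (simp only: card_image[OF inj_on_subset[OF inj Collect_subset]])
    have "\<bar>real (card ?K) / real N - (\<Prod>i\<in>UNIV. real (a i) / real N)\<bar> \<le> dual_sum N (($) g)"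
      by (rule count_minus_expected_le_dual_sum[OF N0 a_le])
    moreover have "\<bar>(\<Prod>i\<in>UNIV. real (a i) / real N) - (\<Prod>i\<in>UNIV. \<alpha> $ i)\<bar> \<le> real CARD('d) / real N"
    proof -
      \<comment> \<open>Telescoping of the product, valid because all factors lie in
        \<open>[0, 1]\<close>.\<close>
      have "\<bar>(\<Prod>i\<in>UNIV. real (a i) / real N) - (\<Prod>i\<in>UNIV. \<alpha> $ i)\<bar>
          \<le> (\<Sum>i\<in>UNIV. \<bar>real (a i) / real N - \<alpha> $ i\<bar>)"
        using norm_prod_diff[of UNIV "\<lambda>i. real (a i) / real N" "\<lambda>i. \<alpha> $ i"] a_le N0 \<alpha> by simp
      also have "\<dots> \<le> (\<Sum>i\<in>(UNIV :: 'd set). 1 / real N)"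
      proof (rule sum_mono)
        fix i
        have "\<bar>real (a i) - \<alpha> $ i * real N\<bar> \<le> 1" using \<alpha>N(1)[of i] unfolding a_def by linarith
        then have "\<bar>real (a i) - \<alpha> $ i * real N\<bar> / real N \<le> 1 / real N"
          by (intro divide_right_mono) auto
        moreover have "real (a i) / real N - \<alpha> $ i = (real (a i) - \<alpha> $ i * real N) / real N"
          using N0 by (simp add: field_simps)
        ultimately show "\<bar>real (a i) / real N - \<alpha> $ i\<bar> \<le> 1 / real N" by (simp add: abs_divide)
      qed
      finally show ?thesis by simp
    qed
    ultimately show "\<bar>real (card (lattice_points g N \<inter> {x. \<forall>i. 0 \<le> x $ i \<and> x $ i < \<alpha> $ i}))
          / real (card (lattice_points g N)) - (\<Prod>i\<in>UNIV. \<alpha> $ i)\<bar>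
        \<le> dual_sum N (($) g) + real CARD('d) / real N"
      unfolding cardP count by linarith
  qed
qed

subsection \<open>Good generators\<close>

text \<open>Here \<open>s ^ d = N\<close>, and \<open>r\<close>, \<open>m\<close>, \<open>t\<close>
  are chosen so that each first moment bound becomes a proportion of at most
  \<open>\<epsilon>\<close>. The guard \<open>2 * m \<le> N\<close> supplies
  \<open>m \<le> N\<close> for the collision argument; the opposite case is settled directly in the
  bound for the mesh ratio.\<close>

lemma card_bad_generators_le:
  fixes \<epsilon> :: real
  assumes N: "prime N" and \<epsilon>: "0 < \<epsilon>" "\<epsilon> < 1"
  defines "s \<equiv> real N powr (1 / real CARD('d::finite))"
  defines "r \<equiv> \<epsilon> * real N / (4 * s)" and "m \<equiv> nat \<lceil>real N / (\<epsilon> * s)\<rceil>"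
    and "t \<equiv> (4 * ln (real N)) ^ CARD('d) / (\<epsilon> * (real N - 1))"
  shows "real (card {g \<in> (UNIV \<rightarrow>\<^sub>E {1..<N} :: ('d \<Rightarrow> nat) set).
      \<exists>k\<in>{1..<N}. \<forall>i. real ((k * g i) mod N) \<le> r \<or> real N - real ((k * g i) mod N) \<le> r})
      \<le> \<epsilon> * (real N - 1) ^ CARD('d)" (is "real (card ?A) \<le> _")
    and "real (card {g \<in> (UNIV \<rightarrow>\<^sub>E {1..<N} :: ('d \<Rightarrow> nat) set). 2 * m \<le> N \<and> \<not> box_covering N m g})
      \<le> \<epsilon> * (real N - 1) ^ CARD('d)" (is "real (card ?B) \<le> _")
    and "real (card {g \<in> (UNIV \<rightarrow>\<^sub>E {1..<N} :: ('d \<Rightarrow> nat) set). t \<le> dual_sum N g})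
      \<le> \<epsilon> * (real N - 1) ^ CARD('d)" (is "real (card ?C) \<le> _")
proof -
  let ?d = "CARD('d)"
  define n where "n = real N"
  have n: "n \<ge> 2" using prime_ge_2_nat[OF N] by (simp add: n_def)
  have n1: "real (N - 1) = n - 1" using prime_ge_2_nat[OF N] by (simp add: n_def of_nat_diff)
  have s: "s > 0" "s ^ ?d = n"
    using n by (simp_all add: s_def n_def powr_power)
  \<comment> \<open>Spares a \<open>d\<close>-th root of \<open>\<epsilon>\<close> in the
    definitions of \<open>r\<close> and \<open>m\<close>.\<close>
  have \<epsilon>d: "\<epsilon> ^ ?d \<le> \<epsilon>"
    using power_decreasing[of 1 ?d \<epsilon>] \<epsilon> by (simp add: Suc_leI)
  have "real (card ?A) \<le> (n - 1) * (2 * r) ^ ?d"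
    unfolding n1 [symmetric] using s \<epsilon> by (intro card_close_multiples_le N) (auto simp: r_def)
  also have "\<dots> \<le> (n - 1) * (\<epsilon> * (n - 1) / s) ^ ?d"
  proof (intro mult_left_mono power_mono)
    \<comment> \<open>Of the 4 in \<open>r\<close>, one factor 2 offsets \<open>2 * r\<close> and
      the other pays for \<open>n \<le> 2 * (n - 1)\<close>.\<close>
    have "\<epsilon> * n \<le> \<epsilon> * (2 * (n - 1))" using n \<epsilon> by (intro mult_left_mono) auto
    then show "2 * r \<le> \<epsilon> * (n - 1) / s"
      using s by (simp add: r_def n_def field_simps)
  qed (use n s \<epsilon> in \<open>auto simp: r_def\<close>)
  also have "\<dots> = (\<epsilon> ^ ?d * (n - 1) ^ ?d) * ((n - 1) / n)"
    by (simp add: power_divide power_mult_distrib s(2))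
  also have "\<dots> \<le> (\<epsilon> ^ ?d * (n - 1) ^ ?d) * 1"
    using n \<epsilon> by (intro mult_left_mono) auto
  also have "\<dots> \<le> \<epsilon> * (n - 1) ^ ?d"
    using n \<epsilon>d by (simp add: mult_right_mono)
  finally show "real (card ?A) \<le> \<epsilon> * (real N - 1) ^ ?d" by (simp add: n_def)

  have nm: "n / (\<epsilon> * s) \<le> real m" unfolding m_def n_def by linarith
  have "n / (\<epsilon> * s) > 0" using n \<epsilon> s by simp
  with nm have m1: "1 \<le> m" by linarith
  show "real (card ?B) \<le> \<epsilon> * (real N - 1) ^ ?d"
  proof (cases "2 * m \<le> N")
    case True
    have "(n / (\<epsilon> * s)) ^ ?d \<le> real m ^ ?d"
      using nm n \<epsilon> s by (intro power_mono) auto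
    then have "n ^ ?d \<le> \<epsilon> ^ ?d * n * real m ^ ?d"
      using n \<epsilon> by (simp add: power_divide power_mult_distrib s(2) field_simps)
    also have "\<dots> \<le> \<epsilon> * n * real m ^ ?d"
      using n \<epsilon>d by (intro mult_right_mono) auto
    finally show ?thesis
      using card_not_box_covering_le[OF N m1 _ \<epsilon>(1), where ?'d = 'd] True by (simp add: n_def)
  next
    case False
    then show ?thesis using n \<epsilon> by (simp add: n_def)
  qed

  have fin: "finite (UNIV \<rightarrow>\<^sub>E {1..<N} :: ('d \<Rightarrow> nat) set)" by (intro finite_PiE) auto
  define L where "L = (4 * ln n) ^ ?d"
  have L: "L > 0" using n by (simp add: L_def)
  have t: "t = L / (\<epsilon> * (n - 1))" by (simp add: t_def L_def n_def)
  have "t * real (card ?C) \<le> (\<Sum>g\<in>(UNIV \<rightarrow>\<^sub>E {1..<N} :: ('d \<Rightarrow> nat) set). dual_sum N g)"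
    using L n \<epsilon> by (intro card_Markov fin) (auto simp: t dual_sum_nonneg)
  also have "\<dots> \<le> (n - 1) ^ (?d - 1) * L"
    using sum_dual_sum_le[OF N, where ?'d = 'd] by (simp only: n1 L_def n_def)
  finally have le: "t * real (card ?C) \<le> (n - 1) ^ (?d - 1) * L" .
  have eq: "t * real (card ?C) * (\<epsilon> * (n - 1) / L) = real (card ?C)"
    using L n \<epsilon> by (simp add: t)
  have nonneg: "0 \<le> \<epsilon> * (n - 1) / L" using L n \<epsilon> by simp
  have "real (card ?C) \<le> (n - 1) ^ (?d - 1) * L * (\<epsilon> * (n - 1) / L)"
    using mult_right_mono[OF le nonneg] by (simp only: eq)
  also have "\<dots> = \<epsilon> * ((n - 1) * (n - 1) ^ (?d - 1))" using L by simp
  also have "(n - 1) * (n - 1) ^ (?d - 1) = (n - 1) ^ ?d"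
    by (simp add: power_eq_if)
  finally show "real (card ?C) \<le> \<epsilon> * (real N - 1) ^ ?d" by (simp add: n_def)
qed

text \<open>The bounds for both radii are of order \<open>1 / s\<close>, which cancels in the
  quotient.\<close>

lemma mesh_ratio_lattice_points_le:
  fixes g :: "nat ^ 'd"
  assumes p: "p \<in> {1..\<infinity>}" and N: "prime N" and g: "g \<in> generators N" and \<epsilon>: "0 < \<epsilon>"
  defines "s \<equiv> real N powr (1 / real CARD('d))"
  defines "r \<equiv> \<epsilon> * real N / (4 * s)" and "m \<equiv> nat \<lceil>real N / (\<epsilon> * s)\<rceil>"
  assumes sep: "\<forall>k\<in>{1..<N}. \<exists>i. r < real ((k * g $ i) mod N) \<and> r < real N - real ((k * g $ i) mod N)"
    and cov: "2 * m \<le> N \<longrightarrow> box_covering N m (($) g)"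
  shows "mesh_ratio p (lattice_points g N) \<le> 16 * real CARD('d) * (1 / \<epsilon> + 1) / \<epsilon>"
proof -
  define n where "n = real N"
  have n: "n \<ge> 2" using prime_ge_2_nat[OF N] by (simp add: n_def)
  have N0: "N > 0" using prime_gt_0_nat[OF N] .
  have s: "s > 0" "s \<le> n"
    using n powr_mono[of "1 / real CARD('d)" 1 n] by (simp_all add: s_def n_def Suc_leI)
  let ?R = "2 * ((1 / \<epsilon> + 1) / s)"
  have P: "lattice_points g N = lattice_point N g ` {..<N}" by (rule lattice_points_eq[OF N0])
  have m1: "1 \<le> m"
  proof -
    have "n / (\<epsilon> * s) > 0" using n \<epsilon> s by simp
    then show ?thesis unfolding m_def n_def by linarith
  qed
  have "real m \<le> n / (\<epsilon> * s) + 1"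
  proof -
    have "n / (\<epsilon> * s) > 0" using n \<epsilon> s by simp
    then show ?thesis unfolding m_def n_def by linarith
  qed
  \<comment> \<open>The \<open>+ 1\<close> from the ceiling is absorbed by
    \<open>n / s \<ge> 1\<close>.\<close>
  also have "\<dots> \<le> n / (\<epsilon> * s) + n / s" using s by simp
  also have "\<dots> = n * ((1 / \<epsilon> + 1) / s)" using s \<epsilon> by (simp add: field_simps)
  finally have "2 * real m / n \<le> 2 * (n * ((1 / \<epsilon> + 1) / s)) / n"
    using n by (intro divide_right_mono mult_left_mono) auto
  then have mR: "2 * real m / n \<le> ?R" using n by simp
  have cover: "\<exists>y\<in>lattice_points g N. infnorm (x - y) \<le> ?R" if x: "x \<in> cbox 0 1" for x
  proof (cases "2 * m \<le> N")
    case True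
    then obtain k where "k < N" "infnorm (x - lattice_point N g k) \<le> 2 * real m / real N"
      using exists_lattice_point_near[OF _ m1 True x, of g] cov by blast
    moreover from this(2) mR have "infnorm (x - lattice_point N g k) \<le> ?R"
      unfolding n_def by linarith
    ultimately show ?thesis unfolding P by blast
  next
    case False
    \<comment> \<open>Here \<open>N < 2 * m\<close>, so \<open>?R\<close> is at least 1 and the
      origin alone covers the cube.\<close>
    then have "1 \<le> 2 * real m / n" using n by (simp add: n_def)
    moreover have "infnorm (x - lattice_point N g 0) \<le> 1"
      using x by (intro infnorm_le_cart) (auto simp: mem_box_cart lattice_point_def)
    ultimately have "infnorm (x - lattice_point N g 0) \<le> ?R" using mR by linarith
    then show ?thesis unfolding P using N0 by blast
  qed
  have sep': "r / n \<le> infnorm (x - y)"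
    if "x \<in> lattice_points g N" "y \<in> lattice_points g N" "x \<noteq> y" for x y
    using that infnorm_lattice_point_diff[OF N0 sep] unfolding P n_def by blast
  have rn: "r / n = \<epsilon> / (4 * s)" using n by (simp add: r_def n_def)
  have ne: "lattice_point N g 0 \<noteq> lattice_point N g 1"
    using inj_onD[OF inj_on_lattice_point[OF N g], of 0 1] prime_gt_1_nat[OF N] by auto
  have "mesh_ratio p (lattice_points g N) \<le> real CARD('d) * ?R / (r / n / 2)"
    by (rule mesh_ratio_le[OF p _ _ _ ne cover sep'])
      (use prime_gt_1_nat[OF N] s \<epsilon> in \<open>auto simp: P rn\<close>)
  also have "\<dots> = 16 * real CARD('d) * (1 / \<epsilon> + 1) / \<epsilon>"
    unfolding rn using s \<epsilon> by (simp add: divide_simps)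
  finally show ?thesis .
qed

text \<open>By \<open>N - 1 \<ge> N / 2\<close> the bound on the dual sum gives the first summand of
  the constant; the rounding error \<open>d / N\<close> goes into the second because
  \<open>ln N \<ge> ln 2\<close>.\<close>

lemma star_discrepancy_lattice_points_le:
  fixes g :: "nat ^ 'd"
  assumes N: "prime N" and g: "g \<in> generators N" and \<epsilon>: "0 < \<epsilon>"
    and dual: "dual_sum N (($) g) < (4 * ln (real N)) ^ CARD('d) / (\<epsilon> * (real N - 1))"
  shows "star_discrepancy (lattice_points g N)
    \<le> (2 * 4 ^ CARD('d) / \<epsilon> + real CARD('d) / ln 2 ^ CARD('d)) * ln (real N) ^ CARD('d) / real N"
proof -
  define n where "n = real N"
  let ?l = "ln n ^ CARD('d)"
  have n: "n \<ge> 2" using prime_ge_2_nat[OF N] by (simp add: n_def)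
  have "(4 * ln n) ^ CARD('d) / (\<epsilon> * (n - 1)) \<le> (4 * ln n) ^ CARD('d) / (\<epsilon> * (n / 2))"
    using n \<epsilon> by (intro divide_left_mono mult_left_mono) auto
  also have "\<dots> = 2 * 4 ^ CARD('d) / \<epsilon> * ?l / n"
    by (simp add: power_mult_distrib)
  finally have "dual_sum N (($) g) \<le> 2 * 4 ^ CARD('d) / \<epsilon> * ?l / n"
    using dual by (simp add: n_def)
  moreover have "real CARD('d) / n \<le> real CARD('d) / ln 2 ^ CARD('d) * ?l / n"
  proof -
    have "ln 2 ^ CARD('d) \<le> ?l" using n by (intro power_mono) auto
    then have "1 \<le> ?l / ln 2 ^ CARD('d)" by simp
    then have "real CARD('d) * 1 \<le> real CARD('d) * (?l / ln 2 ^ CARD('d))"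
      by (intro mult_left_mono) auto
    then show ?thesis using n by (intro divide_right_mono) auto
  qed
  ultimately show ?thesis
    using star_discrepancy_le[OF N g] by (simp add: n_def distrib_right add_divide_distrib)
qed

theorem theorem3p7:
  fixes p :: ereal and \<delta> :: real
  assumes "p \<in> {1..\<infinity>}" and "\<delta> \<in> {0<..<1}"
  shows "\<exists>B>0. \<exists>C>0. \<forall>N::nat. prime N \<longrightarrow>
    int (card {g \<in> (generators N :: (nat ^ 'd) set).
        mesh_ratio p (lattice_points g N) \<le> B \<and>
        star_discrepancy (lattice_points g N) \<le> C * ln (real N) ^ CARD('d) / real N})
      \<ge> \<lceil>\<delta> * (real N - 1) ^ CARD('d)\<rceil>"
proof -
  define \<epsilon> where "\<epsilon> = (1 - \<delta>) / 3"
  have \<epsilon>: "0 < \<epsilon>" "\<epsilon> < 1" using assms(2) by (auto simp: \<epsilon>_def)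
  \<comment> \<open>Both constants are fixed before \<open>N\<close> and depend only on the
    dimension and, through \<open>\<epsilon>\<close>, on \<open>\<delta>\<close>.\<close>
  define B where "B = 16 * real CARD('d) * (1 / \<epsilon> + 1) / \<epsilon>"
  define C where "C = 2 * 4 ^ CARD('d) / \<epsilon> + real CARD('d) / ln 2 ^ CARD('d)"
  have "B > 0" using \<epsilon> by (auto simp: B_def intro!: divide_pos_pos mult_pos_pos add_pos_pos)
  moreover have "C > 0" using \<epsilon> by (auto simp: C_def intro!: divide_pos_pos add_pos_pos)
  moreover have "\<lceil>\<delta> * (real N - 1) ^ CARD('d)\<rceil> \<le> int (card {g \<in> (generators N :: (nat ^ 'd) set).
        mesh_ratio p (lattice_points g N) \<le> B \<and>
        star_discrepancy (lattice_points g N) \<le> C * ln (real N) ^ CARD('d) / real N})"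
    (is "_ \<le> int (card ?T)") if N: "prime N" for N
  proof -
    let ?G = "UNIV \<rightarrow>\<^sub>E {1..<N} :: ('d \<Rightarrow> nat) set"
    define s where "s = real N powr (1 / real CARD('d))"
    define r where "r = \<epsilon> * real N / (4 * s)"
    define m where "m = nat \<lceil>real N / (\<epsilon> * s)\<rceil>"
    define t where "t = (4 * ln (real N)) ^ CARD('d) / (\<epsilon> * (real N - 1))"
    let ?b1 = "{g \<in> ?G. \<exists>k\<in>{1..<N}. \<forall>i. real ((k * g i) mod N) \<le> r \<or> real N - real ((k * g i) mod N) \<le> r}"
    let ?b2 = "{g \<in> ?G. 2 * m \<le> N \<and> \<not> box_covering N m g}"
    let ?b3 = "{g \<in> ?G. t \<le> dual_sum N g}"
    let ?bad = "?b1 \<union> ?b2 \<union> ?b3"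
    have fin: "finite ?G" by (intro finite_PiE) auto
    \<comment> \<open>Transfers the counting, done for functions, to vectors.\<close>
    have gen: "vec_lambda ` ?G = generators N"
    proof
      have interval: "{1..N - 1} = {1..<N}" using prime_gt_0_nat[OF N] by auto
      show "vec_lambda ` ?G \<subseteq> generators N"
        unfolding generators_def interval by (auto simp: PiE_iff)
      show "generators N \<subseteq> vec_lambda ` ?G"
      proof
        fix g :: "nat ^ 'd" assume "g \<in> generators N"
        then have "($) g \<in> ?G" unfolding generators_def interval by auto
        moreover have "g = vec_lambda (($) g)" by simp
        ultimately show "g \<in> vec_lambda ` ?G" by blast
      qed
    qed
    note bad_le = card_bad_generators_le[OF N \<epsilon>, where ?'d = 'd, folded s_def, folded r_def m_def t_def]
    have "real (card ?bad) \<le> real (card ?b1) + real (card ?b2) + real (card ?b3)"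
      using card_Un_le[of "?b1 \<union> ?b2" ?b3] card_Un_le[of ?b1 ?b2] by linarith
    also have "\<dots> \<le> 3 * \<epsilon> * (real N - 1) ^ CARD('d)"
      using bad_le by linarith
    also have "\<dots> = (real N - 1) ^ CARD('d) - \<delta> * (real N - 1) ^ CARD('d)"
      by (simp add: \<epsilon>_def left_diff_distrib)
    finally have "real (card ?bad) \<le> (real N - 1) ^ CARD('d) - \<delta> * (real N - 1) ^ CARD('d)" .
    moreover have "real (card ?G) = (real N - 1) ^ CARD('d)"
      using prime_ge_2_nat[OF N] by (simp add: card_funcsetE of_nat_diff)
    ultimately have "\<delta> * (real N - 1) ^ CARD('d) \<le> real (card ?G) - real (card ?bad)" by linarith
    also have "\<dots> = real (card (?G - ?bad))"
    proof -
      have sub: "?bad \<subseteq> ?G" by blast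
      have "card ?bad \<le> card ?G" by (rule card_mono[OF fin sub])
      then show ?thesis using fin sub by (simp add: card_Diff_subset finite_subset of_nat_diff)
    qed
    also have "card (?G - ?bad) = card (vec_lambda ` (?G - ?bad) :: (nat ^ 'd) set)"
      by (rule card_image [symmetric]) (auto intro!: inj_onI simp: vec_lambda_inject)
    also have "\<dots> \<le> card ?T"
    proof (rule card_mono)
      show "finite ?T" using fin by (simp flip: gen)
      show "vec_lambda ` (?G - ?bad) \<subseteq> ?T"
      proof (rule image_subsetI)
        fix f assume f: "f \<in> ?G - ?bad"
        define g where "g = vec_lambda f"
        have fg: "f = ($) g" by (simp add: g_def vec_lambda_inverse)
        have g: "g \<in> generators N" using f unfolding gen [symmetric] g_def by blast
        have "\<forall>k\<in>{1..<N}. \<exists>i. r < real ((k * g $ i) mod N) \<and> r < real N - real ((k * g $ i) mod N)"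
          using f unfolding fg by (auto simp: not_le)
        moreover have "2 * m \<le> N \<longrightarrow> box_covering N m (($) g)"
          using f unfolding fg by blast
        ultimately have "mesh_ratio p (lattice_points g N) \<le> B"
          unfolding B_def r_def m_def s_def
          by (rule mesh_ratio_lattice_points_le[OF assms(1) N g \<epsilon>(1)])
        moreover have "dual_sum N (($) g) < t"
          using f unfolding fg by (auto simp: not_le)
        then have "star_discrepancy (lattice_points g N) \<le> C * ln (real N) ^ CARD('d) / real N"
          unfolding C_def t_def by (rule star_discrepancy_lattice_points_le[OF N g \<epsilon>(1)])
        ultimately show "vec_lambda f \<in> ?T" using g by (simp add: g_def)
      qed
    qed
    \<comment> \<open>The count is an integer, so the real inequality already gives the one with the
      ceiling.\<close>
    finally show ?thesis by (simp add: ceiling_le_iff)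
  qed
  ultimately show ?thesis by blast
qed

end
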